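(* There is an absolute constant $C$ such that, for any proper edge-coloring of $K_n$ which uses at most $Kn$ colors, there is a spanning tree of $K_n$ whose edges use at most $CK\log(n/K)$ distinct colors. Moreover, this bound is tight up to the constant factor provided $K\le n/(\log n)^8$: there is an absolute constant $c>0$ such that for all sufficiently large $n$ and all $1\le K\le n/(\log n)^8$ there is a proper edge-coloring of $K_n$ with at most $Kn$ colors in which every spanning tree uses at least $cK\log(n/K)$ distinct colors.
   Context: A proper edge-coloring is one in which each color class is a matching.
   Formalization: The first claim is stated for n ≥ 1 and K ≤ n/2; without an upper bound on K it fails (the rainbow coloring with K = n gives log(n/K) = 0), and K_n has fewer than (n/2)n edges, so every coloring is still covered. *)

theory Defs
  imports Complex_Main
begin

text \<open>Finite simple graphs are given by a vertex set \<open>V\<close> and a set of edges, each edge being a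
  two-element subset of \<open>V\<close>.\<close>

definition complete_edges :: "'a set \<Rightarrow> 'a set set" where
  "complete_edges V = {e. e \<subseteq> V \<and> card e = 2}"

definition matching :: "'a set set \<Rightarrow> bool" where
  "matching M \<longleftrightarrow> pairwise disjnt M"

definition proper_edge_coloring :: "'a set set \<Rightarrow> ('a set \<Rightarrow> 'c) \<Rightarrow> bool" where
  "proper_edge_coloring E col \<longleftrightarrow> (\<forall>c. matching {e \<in> E. col e = c})"

definition num_colors :: "'a set set \<Rightarrow> ('a set \<Rightarrow> 'c) \<Rightarrow> nat" where
  "num_colors E col = card (col ` E)"

definition graph_connected :: "'a set \<Rightarrow> 'a set set \<Rightarrow> bool" where
  "graph_connected V E \<longleftrightarrow>
     V \<noteq> {} \<and> (\<forall>u\<in>V. \<forall>v\<in>V. (u, v) \<in> {(x, y). {x, y} \<in> E}\<^sup>*)"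

text \<open>A cycle is given by the list of its vertices in cyclic order, without repeating the first.\<close>

definition is_cycle :: "'a set set \<Rightarrow> 'a list \<Rightarrow> bool" where
  "is_cycle E vs \<longleftrightarrow> length vs \<ge> 3 \<and> distinct vs \<and>
     (\<forall>i<length vs. {vs ! i, vs ! (Suc i mod length vs)} \<in> E)"

definition is_tree :: "'a set \<Rightarrow> 'a set set \<Rightarrow> bool" where
  "is_tree V T \<longleftrightarrow> T \<subseteq> complete_edges V \<and> graph_connected V T \<and> \<not> (\<exists>vs. is_cycle T vs)"

definition is_spanning_tree :: "'a set \<Rightarrow> 'a set set \<Rightarrow> 'a set set \<Rightarrow> bool" where
  "is_spanning_tree V E T \<longleftrightarrow> T \<subseteq> E \<and> is_tree V T"

end

theory Submission
  imports Defs
begin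

text \<open>
  Upper bound: choose colors greedily. If the chosen colors leave \<open>m\<close> components, some color reduces
  \<open>m - 1\<close> by the factor \<open>1 - 1 / (4 * K)\<close>, so \<open>4 * K * ln (n / K)\<close> colors leave about \<open>K\<close>
  components, which are joined by single edges.

  Lower bound for large \<open>K\<close>: about \<open>K\<close> families of special vertices are indexed by the \<open>h\<close>-subsets of
  a \<open>2 * h\<close>-set, where \<open>h\<close> is of order \<open>ln (n / K)\<close>. The colors at the vertex \<open>A\<close> are tagged by
  elements of \<open>A\<close>, so at most \<open>h\<close> tags in one family leave a special vertex isolated.

  Lower bound for bounded \<open>K\<close>: there is no room for extra colors. For even \<open>v\<close>, the vertices of \<open>K\<^sub>v\<close>
  are split into \<open>2 ^ j\<close> blocks, indexed by the elementary abelian group of rank \<open>j\<close>, of nearly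
  equal even size, and \<open>K\<^sub>v\<close> is colored with \<open>v - 1\<close> colors such that every color only joins blocks
  that differ by one group element. Fewer than \<open>j\<close> colors do not generate the group and thus do not
  connect the blocks. Odd \<open>n\<close> is handled by deleting a vertex from \<open>K\<^sub>v\<close> with \<open>v = n + 1\<close>.
\<close>

section \<open>Spanning trees with few colors\<close>

definition adj :: "'a set set \<Rightarrow> ('a \<times> 'a) set" where
  "adj F = {(x, y). {x, y} \<in> F}"

definition component :: "'a set \<Rightarrow> 'a set set \<Rightarrow> 'a \<Rightarrow> 'a set" where
  "component V F v = {w \<in> V. (v, w) \<in> (adj F)\<^sup>*}"

lemma adj_mono: "F \<subseteq> G \<Longrightarrow> adj F \<subseteq> adj G"
  by (auto simp: adj_def)

lemma adj_rtrancl_sym: "(x, y) \<in> (adj F)\<^sup>* \<Longrightarrow> (y, x) \<in> (adj F)\<^sup>*"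
proof -
  have "sym (adj F)" by (auto simp: sym_def adj_def insert_commute)
  then show "(x, y) \<in> (adj F)\<^sup>* \<Longrightarrow> (y, x) \<in> (adj F)\<^sup>*" by (blast dest: sym_rtrancl symD)
qed

lemma graph_connected_adj:
  "graph_connected V F \<longleftrightarrow> V \<noteq> {} \<and> (\<forall>u\<in>V. \<forall>v\<in>V. (u, v) \<in> (adj F)\<^sup>*)"
  by (simp add: graph_connected_def adj_def)

lemma component_eq_iff:
  assumes "u \<in> V" "v \<in> V"
  shows "component V F u = component V F v \<longleftrightarrow> (u, v) \<in> (adj F)\<^sup>*"
proof
  assume "component V F u = component V F v"
  moreover have "v \<in> component V F v" using assms by (simp add: component_def)
  ultimately show "(u, v) \<in> (adj F)\<^sup>*" by (auto simp: component_def)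
next
  assume uv: "(u, v) \<in> (adj F)\<^sup>*"
  then show "component V F u = component V F v"
    unfolding component_def
    using adj_rtrancl_sym[OF uv] by (auto intro: rtrancl_trans)
qed

text \<open>The rest of the cycle is a path between the ends of the deleted edge, so every walk
  through that edge can be rerouted.\<close>

lemma connected_delete_cycle_edge:
  assumes conn: "graph_connected V T" and cyc: "is_cycle T vs"
  shows "graph_connected V (T - {{vs ! 0, vs ! 1}})"
proof -
  define L where "L = length vs"
  define e where "e = {vs ! 0, vs ! 1}"
  have L: "L \<ge> 3" "distinct vs" and ed: "\<And>i. i < L \<Longrightarrow> {vs ! i, vs ! (Suc i mod L)} \<in> T"
    using cyc by (auto simp: is_cycle_def L_def)
  have inj: "vs ! i = vs ! k \<longleftrightarrow> i = k" if "i < L" "k < L" for i k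
    using L that by (simp add: L_def nth_eq_iff_index_eq)
  have path: "(vs ! 1, vs ! (Suc i)) \<in> (adj (T - {e}))\<^sup>*" if "Suc i < L" for i
    using that
  proof (induction i)
    case (Suc i)
    have "{vs ! Suc i, vs ! Suc (Suc i)} \<in> T" using ed[of "Suc i"] Suc.prems by simp
    moreover have "{vs ! Suc i, vs ! Suc (Suc i)} \<noteq> e"
      using Suc.prems L by (auto simp: e_def doubleton_eq_iff inj)
    ultimately have "(vs ! Suc i, vs ! Suc (Suc i)) \<in> adj (T - {e})" by (simp add: adj_def)
    then show ?case using Suc by (meson Suc_lessD rtrancl.rtrancl_into_rtrancl)
  qed simp
  have "(vs ! 1, vs ! (L - 1)) \<in> (adj (T - {e}))\<^sup>*"
    using path[of "L - 2"] L by (simp add: numeral_2_eq_2 Suc_diff_Suc)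
  moreover have "(vs ! (L - 1), vs ! 0) \<in> adj (T - {e})"
  proof -
    have "{vs ! (L - 1), vs ! 0} \<in> T" using ed[of "L - 1"] L by simp
    moreover have "{vs ! (L - 1), vs ! 0} \<noteq> e"
    proof
      assume eq: "{vs ! (L - 1), vs ! 0} = e"
      have "L - 1 = 1"
        using eq L inj[of "L-1" 0] inj[of "L-1" 1] inj[of 0 1]
        by (auto simp: e_def doubleton_eq_iff)
      then show False using L by simp
    qed
    ultimately show ?thesis by (simp add: adj_def)
  qed
  ultimately have e10: "(vs ! 1, vs ! 0) \<in> (adj (T - {e}))\<^sup>*" by (rule rtrancl_into_rtrancl)
  have "adj T \<subseteq> (adj (T - {e}))\<^sup>*"
  proof clarify
    fix x y assume xy: "(x, y) \<in> adj T"
    show "(x, y) \<in> (adj (T - {e}))\<^sup>*"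
    proof (cases "{x, y} = e")
      case True
      then have "(x, y) = (vs ! 1, vs ! 0) \<or> (y, x) = (vs ! 1, vs ! 0)"
        by (auto simp: e_def doubleton_eq_iff)
      then show ?thesis using e10 adj_rtrancl_sym by auto
    next
      case False
      then show ?thesis using xy by (intro r_into_rtrancl) (simp add: adj_def)
    qed
  qed
  then have "(adj T)\<^sup>* \<subseteq> (adj (T - {e}))\<^sup>*" by (metis rtrancl_subset_rtrancl)
  then show ?thesis using conn unfolding graph_connected_adj e_def by blast
qed

text \<open>A connected edge set of minimum size is acyclic, as an edge of a cycle could be
  deleted.\<close>

lemma connected_contains_spanning_tree:
  assumes "finite V" "F \<subseteq> complete_edges V" "graph_connected V F"
  shows "\<exists>T\<subseteq>F. is_spanning_tree V (complete_edges V) T"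
proof -
  have "finite F"
    using assms(1,2) by (auto intro: finite_subset[of F "Pow V"] simp: complete_edges_def)
  obtain T where T: "T \<subseteq> F" "graph_connected V T"
    and min: "\<And>T'. T' \<subseteq> F \<Longrightarrow> graph_connected V T' \<Longrightarrow> card T \<le> card T'"
    using ex_has_least_nat[of "\<lambda>T. T \<subseteq> F \<and> graph_connected V T" F card] assms(3) by blast
  have "\<not> is_cycle T vs" for vs
  proof
    assume cyc: "is_cycle T vs"
    have "3 \<le> length vs" "\<forall>i<length vs. {vs ! i, vs ! (Suc i mod length vs)} \<in> T"
      using cyc by (auto simp: is_cycle_def)
    then have "{vs ! 0, vs ! (Suc 0 mod length vs)} \<in> T" by (metis less_le_trans zero_less_numeral)
    then have "{vs ! 0, vs ! 1} \<in> T" using \<open>3 \<le> length vs\<close> by simp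
    then have "card (T - {{vs ! 0, vs ! 1}}) < card T"
      using T(1) \<open>finite F\<close> by (meson card_Diff1_less finite_subset)
    moreover have "card T \<le> card (T - {{vs ! 0, vs ! 1}})"
      using connected_delete_cycle_edge[OF T(2) cyc] T(1) by (intro min) auto
    ultimately show False by simp
  qed
  then show ?thesis using T assms(2) unfolding is_spanning_tree_def is_tree_def by blast
qed

text \<open>Counted fibre by fibre: a fibre with \<open>f\<close> elements, \<open>r\<close> of them
  in \<open>R\<close>, satisfies \<open>2 + r \<le> 2 * f\<close>, since \<open>f\<close> is at
  least 2 once \<open>r\<close> is positive. In the application \<open>q\<close> sends each old
  component to the new one containing it.\<close>

lemma card_image_fibres:
  assumes "finite A" "R \<subseteq> A" and coll: "\<And>x. x \<in> R \<Longrightarrow> \<exists>y\<in>A. y \<noteq> x \<and> q y = q x"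
  shows "2 * card (q ` A) + card R \<le> 2 * card A"
proof -
  let ?fib = "\<lambda>b. {x \<in> A. q x = b}"
  have A: "card A = (\<Sum>b\<in>q ` A. card (?fib b))"
    using sum.image_gen[OF assms(1), of "\<lambda>_. 1::nat" q] by simp
  have finR: "finite R" using assms finite_subset by blast
  have R: "card R = (\<Sum>b\<in>q ` A. card {x \<in> R. q x = b})"
  proof -
    have "card R = (\<Sum>b\<in>q ` R. card {x \<in> R. q x = b})"
      using sum.image_gen[OF finR, of "\<lambda>_. 1::nat" q] by simp
    also have "\<dots> = (\<Sum>b\<in>q ` A. card {x \<in> R. q x = b})"
    proof (rule sum.mono_neutral_left)
      show "\<forall>b\<in>q ` A - q ` R. card {x \<in> R. q x = b} = 0"
        by (metis (mono_tags, lifting) DiffE card.empty empty_Collect_eq imageI)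
    qed (use assms(1,2) in auto)
    finally show ?thesis .
  qed
  have "2 + card {x \<in> R. q x = b} \<le> 2 * card (?fib b)" if b: "b \<in> q ` A" for b
  proof (cases "{x \<in> R. q x = b} = {}")
    case True
    have "?fib b \<noteq> {}" using b by blast
    then have "card (?fib b) > 0" using assms(1) by (simp add: card_gt_0_iff)
    then show ?thesis using True by (simp only: card.empty)
  next
    case False
    then obtain x where x: "x \<in> R" "q x = b" by auto
    then obtain y where y: "y \<in> A" "y \<noteq> x" "q y = b" using coll by metis
    have "card {x, y} \<le> card (?fib b)"
      using assms x y by (intro card_mono) auto
    moreover have "card {x \<in> R. q x = b} \<le> card (?fib b)"
      using assms by (intro card_mono) auto
    ultimately show ?thesis using y by simp
  qed
  then have "(\<Sum>b\<in>q ` A. 2 + card {x \<in> R. q x = b}) \<le> (\<Sum>b\<in>q ` A. 2 * card (?fib b))"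
    by (rule sum_mono)
  then have "card (q ` A) * 2 + (\<Sum>b\<in>q ` A. card {x \<in> R. q x = b}) \<le> 2 * (\<Sum>b\<in>q ` A. card (?fib b))"
    unfolding sum.distrib sum_distrib_left[symmetric] by simp
  then show ?thesis unfolding A R by simp
qed

section \<open>Merging components greedily, one color at a time\<close>

lemma edge_in_complete_edges: "{u, w} \<in> complete_edges V \<longleftrightarrow> u \<in> V \<and> w \<in> V \<and> u \<noteq> w"
  by (cases "u = w") (auto simp: complete_edges_def)

lemma finite_complete_edges: "finite V \<Longrightarrow> finite (complete_edges V)"
  by (rule finite_subset[of _ "Pow V"]) (auto simp: complete_edges_def)

lemma proper_edge_coloring_inj_on:
  assumes "proper_edge_coloring (complete_edges V) col" "u \<in> V"
  shows "inj_on (\<lambda>w. col {u, w}) (V - {u})"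
proof (rule inj_onI)
  fix w w' assume w: "w \<in> V - {u}" "w' \<in> V - {u}" "col {u, w} = col {u, w'}"
  have "pairwise disjnt {e \<in> complete_edges V. col e = col {u, w}}"
    using assms(1) by (simp add: proper_edge_coloring_def matching_def)
  moreover have "{u, w} \<in> {e \<in> complete_edges V. col e = col {u, w}}"
    "{u, w'} \<in> {e \<in> complete_edges V. col e = col {u, w}}"
    using w assms(2) by (auto simp: edge_in_complete_edges)
  ultimately have "{u, w} = {u, w'} \<or> disjnt {u, w} {u, w'}"
    by (meson pairwiseD)
  then have "{u, w} = {u, w'}" by (simp add: disjnt_def)
  then show "w = w'" by (auto simp: doubleton_eq_iff)
qed

text \<open>Every component with at most half of the vertices is left by at least \<open>card V / 2\<close> colors, namely
  those at any one of its vertices. Averaging over the colors, some color leaves at least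
  \<open>(m - 1) / (2 * K)\<close> components, and adding it at least halves their number.\<close>

lemma greedy_color:
  fixes K :: real
  assumes V: "finite V" and proper: "proper_edge_coloring (complete_edges V) col"
    and few: "real (num_colors (complete_edges V) col) \<le> K * real (card V)"
    and m: "card (component V F ` V) = m" "m \<ge> 2"
  shows "\<exists>c\<in>col ` complete_edges V.
           real (card (component V (F \<union> {e \<in> complete_edges V. col e = c}) ` V)) - 1
             \<le> (real m - 1) * (1 - 1 / (4 * K))"
proof -
  define F' where "F' c = F \<union> {e \<in> complete_edges V. col e = c}" for c
  define E where "E = complete_edges V"
  define n where "n = card V"
  define P where "P = col ` E"
  define Cs where "Cs = component V F ` V"
  define Small where "Small = {C \<in> Cs. 2 * card C \<le> n}"
  define leaves where "leaves C c \<longleftrightarrow> (\<exists>u\<in>C. \<exists>w\<in>V - C. col {u, w} = c)" for C c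
  define R where "R c = {C \<in> Cs. leaves C c}" for c
  have fin: "finite Cs" "finite P" "finite Small"
    using V by (auto simp: Cs_def P_def E_def Small_def finite_complete_edges)
  have sub: "C \<subseteq> V" if "C \<in> Cs" for C using that by (auto simp: Cs_def component_def)
  have disj: "C \<inter> D = {}" if CD: "C \<in> Cs" "D \<in> Cs" "C \<noteq> D" for C D
  proof (rule ccontr)
    assume "C \<inter> D \<noteq> {}"
    then obtain x where x: "x \<in> C" "x \<in> D" by blast
    obtain u v where uv: "u \<in> V" "v \<in> V" "C = component V F u" "D = component V F v"
      using CD by (auto simp: Cs_def)
    have "(u, x) \<in> (adj F)\<^sup>*" "(v, x) \<in> (adj F)\<^sup>*" "x \<in> V"
      using x uv by (auto simp: component_def)
    then have "C = component V F x" "D = component V F x"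
      using uv component_eq_iff by metis+
    then show False using that by simp
  qed
  \<comment> \<open>Two components with more than half of the vertices each do not fit into
    \<open>V\<close>, so all but at most one component are small.\<close>
  have "C = D" if "C \<in> Cs - Small" "D \<in> Cs - Small" for C D
  proof (rule ccontr)
    assume "C \<noteq> D"
    have "card (C \<union> D) = card C + card D"
      using that \<open>C \<noteq> D\<close> finite_subset[OF sub V] by (intro card_Un_disjoint disj) auto
    moreover have "card (C \<union> D) \<le> n" unfolding n_def using that sub V by (intro card_mono) auto
    ultimately show False using that by (auto simp: Small_def)
  qed
  then have "card (Cs - Small) \<le> Suc 0" using fin by (subst card_le_Suc0_iff_eq) auto
  moreover have "card (Cs - Small) = m - card Small"
    using m fin by (subst card_Diff_subset) (auto simp: Small_def Cs_def)
  ultimately have small: "real m - 1 \<le> real (card Small)" using m by linarith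
  have many: "real n / 2 \<le> real (card {c \<in> P. leaves C c})" if C: "C \<in> Small" for C
  proof -
    obtain u where u: "u \<in> V" "C = component V F u" using C by (auto simp: Small_def Cs_def)
    then have uC: "u \<in> C" by (simp add: component_def)
    have "C \<subseteq> V" using C sub by (simp add: Small_def)
    have "n - card C = card (V - C)"
      using \<open>C \<subseteq> V\<close> V unfolding n_def by (metis card_Diff_subset finite_subset)
    also have "\<dots> = card ((\<lambda>w. col {u, w}) ` (V - C))"
      using proper_edge_coloring_inj_on[OF proper u(1)] uC
      by (intro card_image[symmetric]) (auto intro: inj_on_subset)
    also have "\<dots> \<le> card {c \<in> P. leaves C c}"
      using fin u uC by (intro card_mono) (auto simp: P_def E_def leaves_def edge_in_complete_edges)
    finally have "n - card C \<le> card {c \<in> P. leaves C c}" .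
    moreover have "2 * card C \<le> n" using C by (simp add: Small_def)
    ultimately show ?thesis by linarith
  qed
  have "V \<noteq> {}" using m by auto
  then have npos: "n > 0" using V by (simp add: n_def card_gt_0_iff)
  have K: "real (card P) \<le> K * real n" using few by (simp add: num_colors_def P_def E_def n_def)
  \<comment> \<open>Double counting of the pairs of a small component and a color leaving
    it.\<close>
  have "(real m - 1) * (real n / 2) \<le> real (card Small) * (real n / 2)"
    using small by (intro mult_right_mono) auto
  also have "\<dots> \<le> (\<Sum>C\<in>Small. real (card {c \<in> P. leaves C c}))"
    using sum_mono[of Small "\<lambda>_. real n / 2"] many by simp
  also have "\<dots> = real (\<Sum>C\<in>Small. \<Sum>c\<in>P. of_bool (leaves C c))"
    using fin by (simp add: Int_def)
  also have "\<dots> = real (\<Sum>c\<in>P. \<Sum>C\<in>Small. of_bool (leaves C c))"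
    by (subst sum.swap) simp
  also have "\<dots> \<le> real (\<Sum>c\<in>P. card (R c))"
  proof -
    have "(\<Sum>C\<in>Small. of_bool (leaves C c)) \<le> card (R c)" for c
    proof -
      have "(\<Sum>C\<in>Small. of_bool (leaves C c)) = card {C \<in> Small. leaves C c}"
        using fin by (simp add: Int_def)
      also have "\<dots> \<le> card (R c)" using fin by (intro card_mono) (auto simp: R_def Small_def)
      finally show ?thesis .
    qed
    then show ?thesis unfolding of_nat_le_iff by (intro sum_mono)
  qed
  finally have total: "(real m - 1) * (real n / 2) \<le> (\<Sum>c\<in>P. real (card (R c)))" by simp
  have lhs_pos: "(real m - 1) * (real n / 2) > 0" using m npos by simp
  then have "P \<noteq> {}" using total by auto
  then have "card P > 0" using fin by (simp add: card_gt_0_iff)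
  then have "K * real n > 0" using K by linarith
  then have Kpos: "K > 0" using npos by (simp add: zero_less_mult_iff)
  obtain c where c: "c \<in> P" "(real m - 1) / (2 * K) \<le> real (card (R c))"
  proof (rule ccontr)
    assume "\<not> thesis"
    then have "\<And>c. c \<in> P \<Longrightarrow> real (card (R c)) < (real m - 1) / (2 * K)" using that not_le by blast
    then have "(\<Sum>c\<in>P. real (card (R c))) < (\<Sum>c\<in>P. (real m - 1) / (2 * K))"
      using fin \<open>P \<noteq> {}\<close> by (intro sum_strict_mono) auto
    also have "\<dots> = real (card P) * ((real m - 1) / (2 * K))" by simp
    also have "\<dots> \<le> K * real n * ((real m - 1) / (2 * K))"
      using K Kpos m by (intro mult_right_mono) auto
    also have "\<dots> = (real m - 1) * (real n / 2)" using Kpos by (simp add: field_simps)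
    finally show False using total by simp
  qed
  \<comment> \<open>The old component lies in a single new one, so the representative picked by
    \<open>SOME\<close> does not matter.\<close>
  define q where "q C = component V (F' c) (SOME v. v \<in> C)" for C
  have q: "q (component V F v) = component V (F' c) v" if "v \<in> V" for v
  proof -
    have "v \<in> component V F v" using that by (simp add: component_def)
    then have s: "(SOME w. w \<in> component V F v) \<in> component V F v" by (rule someI)
    moreover have "(adj F)\<^sup>* \<subseteq> (adj (F' c))\<^sup>*" by (intro rtrancl_mono adj_mono) (simp add: F'_def)
    ultimately have "(v, SOME w. w \<in> component V F v) \<in> (adj (F' c))\<^sup>*"
      unfolding component_def by blast
    moreover have "(SOME w. w \<in> component V F v) \<in> V" using s by (simp add: component_def)
    ultimately show ?thesis unfolding q_def using that component_eq_iff by metis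
  qed
  have qCs: "q ` Cs = component V (F' c) ` V" using q by (auto simp: Cs_def image_image)
  have "2 * card (q ` Cs) + card (R c) \<le> 2 * card Cs"
  proof (rule card_image_fibres[OF fin(1)])
    show "R c \<subseteq> Cs" by (auto simp: R_def)
    fix C assume "C \<in> R c"
    then obtain u w where C: "C \<in> Cs" "u \<in> C" "w \<in> V" "w \<notin> C" "col {u, w} = c"
      by (auto simp: R_def leaves_def)
    then have u: "u \<in> V" using sub by blast
    obtain v where v: "v \<in> V" "C = component V F v" using C by (auto simp: Cs_def)
    then have "(v, u) \<in> (adj F)\<^sup>*" using C by (simp add: component_def)
    then have Cu: "C = component V F u" using v u component_eq_iff by metis
    have "u \<noteq> w" using C by blast
    have "(u, w) \<in> adj (F' c)" using C u \<open>u \<noteq> w\<close> by (simp add: adj_def F'_def edge_in_complete_edges)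
    then have "component V (F' c) w = component V (F' c) u"
      using u C component_eq_iff[of u V w "F' c"] by auto
    then have "q (component V F w) = q C" using q u C by (simp add: Cu)
    moreover have "component V F w \<noteq> C" using C by (auto simp: component_def)
    moreover have "component V F w \<in> Cs" using C by (simp add: Cs_def)
    ultimately show "\<exists>y\<in>Cs. y \<noteq> C \<and> q y = q C" by blast
  qed
  then have "real (card (component V (F' c) ` V)) \<le> real m - real (card (R c)) / 2"
    using m(1) unfolding qCs unfolding Cs_def by linarith
  also have "\<dots> \<le> real m - (real m - 1) / (2 * K) / 2"
    using c(2) by (intro diff_left_mono divide_right_mono) auto
  finally have "real (card (component V (F' c) ` V)) - 1 \<le> (real m - 1) * (1 - 1 / (4 * K))"
    using Kpos by (simp add: field_simps)
  then show ?thesis using c by (auto simp: P_def E_def F'_def)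
qed

text \<open>\<open>greedy_color\<close> is iterated while at least two components are left.
  Afterwards the left side is at most 0 and the right side is nonnegative because
  \<open>K \<ge> 1 / 2\<close>.\<close>

lemma greedy_colors:
  fixes K :: real
  assumes V: "finite V" and proper: "proper_edge_coloring (complete_edges V) col"
    and few: "real (num_colors (complete_edges V) col) \<le> K * real (card V)" and K: "K \<ge> 1 / 2"
  shows "\<exists>S. finite S \<and> card S \<le> t \<and>
           real (card (component V {e \<in> complete_edges V. col e \<in> S} ` V)) - 1
             \<le> real (card V) * (1 - 1 / (4 * K)) ^ t"
proof (induction t)
  case 0
  have "card (component V {} ` V) \<le> card V" using V by (rule card_image_le)
  then show ?case by (intro exI[of _ "{}"]) simp
next
  case (Suc t)
  define G where "G S = {e \<in> complete_edges V. col e \<in> S}" for S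
  define m where "m S = card (component V (G S) ` V)" for S
  have q: "0 \<le> 1 - 1 / (4 * K)" using K by (simp add: field_simps)
  obtain S where S: "finite S" "card S \<le> t" "real (m S) - 1 \<le> real (card V) * (1 - 1 / (4 * K)) ^ t"
    using Suc.IH by (auto simp: m_def G_def)
  show ?case
  proof (cases "m S \<ge> 2")
    case True
    have "\<exists>c\<in>col ` complete_edges V.
        real (card (component V (G S \<union> {e \<in> complete_edges V. col e = c}) ` V)) - 1
        \<le> (real (m S) - 1) * (1 - 1 / (4 * K))"
      using True by (intro greedy_color[OF V proper few]) (auto simp: m_def)
    then obtain c where "real (card (component V (G S \<union> {e \<in> complete_edges V. col e = c}) ` V)) - 1
        \<le> (real (m S) - 1) * (1 - 1 / (4 * K))" by blast
    moreover have "G S \<union> {e \<in> complete_edges V. col e = c} = G (insert c S)"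
      by (auto simp: G_def)
    ultimately have "real (m (insert c S)) - 1 \<le> (real (m S) - 1) * (1 - 1 / (4 * K))"
      by (simp add: m_def)
    also have "\<dots> \<le> real (card V) * (1 - 1 / (4 * K)) ^ t * (1 - 1 / (4 * K))"
      using S q by (intro mult_right_mono) auto
    finally have "real (m (insert c S)) - 1 \<le> real (card V) * (1 - 1 / (4 * K)) ^ Suc t"
      by (simp add: mult_ac)
    moreover have "card (insert c S) \<le> Suc t" using S by (simp add: card_insert_if)
    ultimately show ?thesis using S unfolding m_def G_def by blast
  next
    case False
    have "0 \<le> real (card V) * (1 - 1 / (4 * K)) ^ Suc t" using q by (intro mult_nonneg_nonneg) auto
    then have "real (m S) - 1 \<le> real (card V) * (1 - 1 / (4 * K)) ^ Suc t" using False by linarith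
    then show ?thesis using S le_SucI unfolding m_def G_def by blast
  qed
qed

text \<open>A star from a fixed vertex to one representative of every other component joins the
  components at the cost of one edge each.\<close>

lemma spanning_tree_few_components:
  assumes V: "finite V" "V \<noteq> {}" and F: "F \<subseteq> complete_edges V"
  shows "\<exists>T. is_spanning_tree V (complete_edges V) T
           \<and> card (T - F) \<le> card (component V F ` V) - 1"
proof -
  obtain v where v: "v \<in> V" using V by blast
  define Cs where "Cs = component V F ` V - {component V F v}"
  define rep where "rep C = (SOME w. w \<in> V \<and> component V F w = C)" for C
  have rep: "rep C \<in> V" "component V F (rep C) = C" if "C \<in> Cs" for C
    using someI_ex[of "\<lambda>w. w \<in> V \<and> component V F w = C"] that by (auto simp: Cs_def rep_def)
  define X where "X = (\<lambda>C. {v, rep C}) ` Cs"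
  have fin: "finite Cs" using V by (simp add: Cs_def)
  have "card X \<le> card Cs" unfolding X_def using fin by (rule card_image_le)
  also have "\<dots> = card (component V F ` V) - 1" unfolding Cs_def using v V by (subst card_Diff_singleton) auto
  finally have cX: "card X \<le> card (component V F ` V) - 1" .
  have "rep C \<noteq> v" if "C \<in> Cs" for C using rep(2)[OF that] that by (auto simp: Cs_def)
  then have X: "X \<subseteq> complete_edges V"
    using rep v by (fastforce simp: X_def edge_in_complete_edges)
  have vu: "(v, u) \<in> (adj (F \<union> X))\<^sup>*" if u: "u \<in> V" for u
  proof (cases "component V F u = component V F v")
    case True
    then have "(v, u) \<in> (adj F)\<^sup>*" using u v component_eq_iff by metis
    then show ?thesis using rtrancl_mono[OF adj_mono[of F "F \<union> X"]] by blast
  next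
    case False
    then have C: "component V F u \<in> Cs" using u by (simp add: Cs_def)
    then have "(rep (component V F u), u) \<in> (adj F)\<^sup>*" using rep[OF C] u component_eq_iff by metis
    then have "(rep (component V F u), u) \<in> (adj (F \<union> X))\<^sup>*"
      using rtrancl_mono[OF adj_mono[of F "F \<union> X"]] by blast
    moreover have "(v, rep (component V F u)) \<in> adj (F \<union> X)" using C by (simp add: adj_def X_def)
    ultimately show ?thesis by (rule converse_rtrancl_into_rtrancl[rotated])
  qed
  then have "graph_connected V (F \<union> X)"
    unfolding graph_connected_adj using V adj_rtrancl_sym rtrancl_trans by metis
  then obtain T where T: "T \<subseteq> F \<union> X" "is_spanning_tree V (complete_edges V) T"
    using connected_contains_spanning_tree[OF V(1), of "F \<union> X"] F X by blast
  have "card (T - F) \<le> card X" using T fin by (intro card_mono) (auto simp: X_def)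
  then show ?thesis using T cX by (meson le_trans)
qed

theorem spanning_tree_few_colors:
  fixes K :: real
  assumes V: "finite V" "V \<noteq> {}" and Kn: "K \<le> real (card V) / 2"
    and proper: "proper_edge_coloring (complete_edges V) col"
    and few: "real (num_colors (complete_edges V) col) \<le> K * real (card V)"
  shows "\<exists>T. is_spanning_tree V (complete_edges V) T \<and>
           real (num_colors T col) \<le> 10 * K * ln (real (card V) / K)"
proof (cases "card V = 1")
  case True
  then obtain v where v: "V = {v}" by (auto simp: card_1_singleton_iff)
  have "is_spanning_tree V (complete_edges V) {}"
    by (auto simp: is_spanning_tree_def is_tree_def graph_connected_def v is_cycle_def
      intro: exI[of _ 0])
  moreover have "complete_edges V = {}" by (auto simp: v complete_edges_def subset_singleton_iff)
  \<comment> \<open>For a single vertex only the sign of the bound matters: the logarithm is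
    nonnegative for \<open>0 < K \<le> 1 / 2\<close>, and the product vanishes at
    \<open>K = 0\<close>.\<close>
  then have "K \<ge> 0" "K \<le> 1 / 2" using few Kn True by (auto simp: num_colors_def)
  then have "10 * K * ln (real (card V) / K) \<ge> 0"
    using True by (cases "K = 0") (auto simp: ln_div field_simps intro!: mult_nonneg_nonpos)
  ultimately show ?thesis by (auto simp: num_colors_def)
next
  case False
  define n where "n = card V"
  have n: "n \<ge> 2" using V False unfolding n_def by (metis One_nat_def Suc_leI card_0_eq le_neq_implies_less nat_neq_iff not_less_eq_eq numeral_2_eq_2 less_one)
  obtain v where v: "v \<in> V" using V by blast
  \<comment> \<open>The edges at \<open>v\<close> alone need \<open>n - 1\<close> colors, which
    forces \<open>K \<ge> 1 / 2\<close>.\<close>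
  have "n - 1 = card ((\<lambda>w. col {v, w}) ` (V - {v}))"
    using card_image[OF proper_edge_coloring_inj_on[OF proper v]] V v by (simp add: n_def)
  also have "\<dots> \<le> num_colors (complete_edges V) col"
    unfolding num_colors_def using V v
    by (intro card_mono) (auto simp: finite_complete_edges edge_in_complete_edges)
  finally have "real n - 1 \<le> K * real n" using few n unfolding n_def by linarith
  then have "1 / 2 * real n \<le> K * real n" using n by linarith
  then have K: "K \<ge> 1 / 2" using n by (subst (asm) mult_le_cancel_right) auto
  define L where "L = ln (real n / K)"
  have expL: "exp (- L) = K / real n" unfolding L_def using K n by (simp add: exp_minus)
  also have "\<dots> \<le> 1 / 2" using Kn n by (simp add: n_def field_simps)
  finally have L: "L \<ge> 1 / 2" using exp_ge_add_one_self[of "- L"] by linarith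
  \<comment> \<open>This many steps push the decay factor below \<open>exp (- L) = K / n\<close>,
    which leaves at most \<open>K + 1\<close> components.\<close>
  define t where "t = nat \<lceil>4 * K * L\<rceil>"
  have t: "4 * K * L \<le> real t" "real t \<le> 4 * K * L + 1"
  proof -
    have "0 \<le> 4 * K * L" using K L by simp
    then show "4 * K * L \<le> real t" "real t \<le> 4 * K * L + 1" unfolding t_def by linarith+
  qed
  obtain S where S: "finite S" "card S \<le> t"
    "real (card (component V {e \<in> complete_edges V. col e \<in> S} ` V)) - 1 \<le> real n * (1 - 1 / (4 * K)) ^ t"
    using greedy_colors[OF V(1) proper few K, of t] unfolding n_def by blast
  define F where "F = {e \<in> complete_edges V. col e \<in> S}"
  have "(1 - 1 / (4 * K)) ^ t \<le> exp (- (1 / (4 * K))) ^ t"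
    using K exp_ge_add_one_self[of "- (1 / (4 * K))"] by (intro power_mono) (auto simp: field_simps)
  also have "\<dots> = exp (- (real t / (4 * K)))" by (simp flip: exp_of_nat_mult)
  also have "\<dots> \<le> exp (- L)" using t K by (simp add: field_simps)
  also have "\<dots> = K / real n" by (rule expL)
  finally have "real n * (1 - 1 / (4 * K)) ^ t \<le> K" using n by (simp add: field_simps)
  then have m: "real (card (component V F ` V)) - 1 \<le> K" using S unfolding F_def by linarith
  obtain T where T: "is_spanning_tree V (complete_edges V) T"
    "card (T - F) \<le> card (component V F ` V) - 1"
    using spanning_tree_few_components[OF V, of F] unfolding F_def by blast
  have "finite T" using T(1) V unfolding is_spanning_tree_def by (meson finite_complete_edges finite_subset)
  have "num_colors T col \<le> card (S \<union> col ` (T - F))"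
    unfolding num_colors_def using \<open>finite T\<close> S by (intro card_mono) (auto simp: F_def)
  also have "\<dots> \<le> card S + card (T - F)"
    using card_Un_le card_image_le \<open>finite T\<close> by (meson add_left_mono finite_Diff le_trans)
  finally have "num_colors T col \<le> card S + card (T - F)" .
  moreover have "card (component V F ` V) > 0" using V by (simp add: card_gt_0_iff)
  ultimately have "real (num_colors T col) \<le> real t + (real (card (component V F ` V)) - 1)"
    using S(2) T(2) by linarith
  also have "\<dots> \<le> 4 * K * L + 1 + K" using t m by linarith
  \<comment> \<open>From \<open>L \<ge> 1 / 2\<close> and \<open>K \<ge> 1 / 2\<close> follows
    \<open>6 * K * L \<ge> 3 * K \<ge> K + 1\<close>.\<close>
  also have "\<dots> \<le> 10 * K * L"
  proof -
    have "K * (1 / 2) \<le> K * L" using K L by (intro mult_left_mono) auto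
    then show ?thesis using K by linarith
  qed
  finally show ?thesis using T unfolding L_def n_def by blast
qed

section \<open>Colorings that isolate a vertex\<close>

text \<open>Allows both constructions to work with symmetric functions of two vertices and
  structured colors. \<open>Min\<close> and \<open>Max\<close> recover the ends of an edge, an
  injection of \<open>P\<close> encodes the colors as numbers, and the last clause transfers lower
  bounds back.\<close>

lemma coloring_from_pairs:
  fixes c :: "nat \<Rightarrow> nat \<Rightarrow> 'c"
  assumes sym: "\<And>x y. c x y = c y x"
    and proper: "\<And>x y z. x < n \<Longrightarrow> y < n \<Longrightarrow> z < n \<Longrightarrow> y \<noteq> x \<Longrightarrow> z \<noteq> x \<Longrightarrow> y \<noteq> z \<Longrightarrow> c x y \<noteq> c x z"
    and P: "finite P" "\<And>x y. x < n \<Longrightarrow> y < n \<Longrightarrow> x \<noteq> y \<Longrightarrow> c x y \<in> P"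
  shows "\<exists>col :: nat set \<Rightarrow> nat. proper_edge_coloring (complete_edges {..<n}) col
    \<and> num_colors (complete_edges {..<n}) col \<le> card P
    \<and> (\<forall>T. T \<subseteq> complete_edges {..<n} \<longrightarrow>
         card {c x y |x y. {x, y} \<in> T} \<le> num_colors T col)"
proof -
  obtain f :: "'c \<Rightarrow> nat" where f: "inj_on f P"
    using finite_imp_inj_to_nat_seg[OF P(1)] by metis
  define col where "col e = f (c (Min e) (Max e))" for e
  have col: "col {x, y} = f (c x y)" for x y
    by (cases "x \<le> y") (auto simp: col_def min_def max_def sym)
  have edge: "\<exists>x y. e = {x, y} \<and> x < n \<and> y < n \<and> x \<noteq> y" if "e \<in> complete_edges {..<n}" for e
    using that by (fastforce simp: complete_edges_def card_2_iff)
  have "matching {e \<in> complete_edges {..<n}. col e = k}" for k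
    unfolding matching_def
  proof (rule pairwiseI)
    fix e e' assume e: "e \<in> {e \<in> complete_edges {..<n}. col e = k}"
      "e' \<in> {e \<in> complete_edges {..<n}. col e = k}" "e \<noteq> e'"
    show "disjnt e e'"
    proof (rule ccontr)
      assume "\<not> disjnt e e'"
      then obtain x where x: "x \<in> e" "x \<in> e'" by (auto simp: disjnt_def)
      obtain y where y: "e = {x, y}" "x < n" "y < n" "y \<noteq> x"
        using edge[of e] e x by (auto simp: insert_commute)
      obtain z where z: "e' = {x, z}" "z < n" "z \<noteq> x"
        using edge[of e'] e x by (auto simp: insert_commute)
      have "f (c x y) = f (c x z)" using e y z col by simp
      then have "c x y = c x z" using f P(2) y z by (metis inj_onD)
      then show False using proper[of x y z] y z e by blast
    qed
  qed
  moreover have "num_colors (complete_edges {..<n}) col \<le> card P"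
  proof -
    have "num_colors (complete_edges {..<n}) col \<le> card (f ` P)"
      unfolding num_colors_def
    proof (rule card_mono)
      show "finite (f ` P)" using P by simp
      show "col ` complete_edges {..<n} \<subseteq> f ` P"
      proof clarify
        fix e assume "e \<in> complete_edges {..<n}"
        then obtain x y where "e = {x, y}" "x < n" "y < n" "x \<noteq> y" using edge by blast
        then show "col e \<in> f ` P" using P(2) col by auto
      qed
    qed
    then show ?thesis using card_image_le[OF P(1)] le_trans by blast
  qed
  moreover have "card {c x y |x y. {x, y} \<in> T} \<le> num_colors T col" if T: "T \<subseteq> complete_edges {..<n}" for T
  proof -
    have sub: "{c x y |x y. {x, y} \<in> T} \<subseteq> P"
    proof clarify
      fix x y assume "{x, y} \<in> T"
      then have "{x, y} \<in> complete_edges {..<n}" using T by blast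
      then show "c x y \<in> P" using P(2) by (simp add: edge_in_complete_edges)
    qed
    have "card {c x y |x y. {x, y} \<in> T} = card (f ` {c x y |x y. {x, y} \<in> T})"
      using f sub by (intro card_image[symmetric]) (rule inj_on_subset)
    also have "\<dots> \<le> num_colors T col"
      unfolding num_colors_def
    proof (rule card_mono)
      show "finite (col ` T)" using T finite_complete_edges[of "{..<n}"] by (auto intro: finite_subset)
      show "f ` {c x y |x y. {x, y} \<in> T} \<subseteq> col ` T"
      proof clarify
        fix x y assume "{x, y} \<in> T"
        then have "col {x, y} \<in> col ` T" by (rule imageI)
        then show "f (c x y) \<in> col ` T" by (simp only: col)
      qed
    qed
    finally show ?thesis .
  qed
  ultimately show ?thesis unfolding proper_edge_coloring_def by blast
qed

lemma spanning_tree_incident_edge: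
  assumes T: "is_spanning_tree V E T" and x: "x \<in> V" and y: "y \<in> V" "y \<noteq> x"
  shows "\<exists>z. {x, z} \<in> T \<and> z \<in> V \<and> z \<noteq> x"
proof -
  have "(x, y) \<in> (adj T)\<^sup>*" "T \<subseteq> complete_edges V"
    using T x y by (auto simp: is_spanning_tree_def is_tree_def graph_connected_adj)
  then obtain z where z: "{x, z} \<in> T"
    using y(2) by (auto simp: adj_def elim: converse_rtranclE)
  then have "{x, z} \<in> complete_edges V" using \<open>T \<subseteq> complete_edges V\<close> by (rule subsetD[rotated])
  then show ?thesis using z unfolding edge_in_complete_edges by blast
qed

text \<open>The special vertices are indexed by a row \<open>i < B\<close> and an \<open>h\<close>-subset \<open>A\<close> of \<open>{..<2 * h}\<close>.
  Every color carries at most two tags \<open>(i, a)\<close>, and every edge at the special vertex \<open>(i, A)\<close>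
  has a tag \<open>(i, a)\<close> with \<open>a \<in> A\<close>. Hence colors whose tags use at most \<open>h\<close> elements of row \<open>i\<close>
  isolate the vertex \<open>(i, A)\<close> for an \<open>A\<close> in the complement. An edge from a special vertex \<open>x\<close> to
  an ordinary vertex \<open>y\<close> gets the tag chosen by \<open>y mod h\<close>, while \<open>y div h + x\<close> keeps the coloring
  proper.\<close>

lemma coloring_isolating_tags:
  fixes n B h :: nat
  assumes h: "h \<ge> 1" and B: "B \<ge> 1" and size: "B * 4 ^ h < n"
  shows "\<exists>col :: nat set \<Rightarrow> nat. proper_edge_coloring (complete_edges {..<n}) col
    \<and> num_colors (complete_edges {..<n}) col \<le> 2 * B * n + 2 * n + (B * 4 ^ h)\<^sup>2 + 2 * B * h * (B * 4 ^ h + 1)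
    \<and> (\<forall>T. is_spanning_tree {..<n} (complete_edges {..<n}) T \<longrightarrow> B * (h + 1) \<le> 2 * num_colors T col)"
proof -
  define Sp where "Sp = {..<B} \<times> {A. A \<subseteq> {..<2 * h} \<and> card A = h}"
  define s where "s = card Sp"
  have "card Sp = B * ((2 * h) choose h)"
    unfolding Sp_def using n_subsets[of "{..<2 * h}" h] by (simp add: card_cartesian_product)
  moreover have "(2 * h) choose h \<le> 4 ^ h"
    using binomial_le_pow2[of "2 * h" h] by (simp add: power_mult)
  ultimately have s: "s \<le> B * 4 ^ h" unfolding s_def by simp
  have "finite Sp" by (simp add: Sp_def)
  then obtain lab where lab: "bij_betw lab {..<s} Sp"
    using ex_bij_betw_nat_finite[of Sp] unfolding s_def atLeast0LessThan by blast
  have "\<exists>\<phi>. bij_betw \<phi> {..<h} A" if "A \<in> {A. A \<subseteq> {..<2 * h} \<and> card A = h}" for A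
    using ex_bij_betw_nat_finite[of A] that unfolding atLeast0LessThan
    by (metis (mono_tags, lifting) finite_lessThan finite_subset mem_Collect_eq)
  then obtain \<phi> where \<phi>: "\<And>A. A \<subseteq> {..<2 * h} \<Longrightarrow> card A = h \<Longrightarrow> bij_betw (\<phi> A) {..<h} A"
    by (metis (mono_tags, lifting) mem_Collect_eq)
  define row where "row x = fst (lab x)" for x
  define A where "A x = snd (lab x)" for x
  have rowA: "row x < B" "A x \<subseteq> {..<2 * h}" "card (A x) = h" if "x < s" for x
    using bij_betwE[OF lab] that by (force simp: Sp_def row_def A_def)+
  have \<phi>A: "bij_betw (\<phi> (A x)) {..<h} (A x)" if "x < s" for x
    using \<phi>[OF rowA(2,3)] that by simp
  \<comment> \<open>Special vertices are numbered first, so after sorting the arguments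
    \<open>y < s\<close> means that both ends are special. The leading entry separates edges with
    two, one and no special ends; edges with two special ends get private colors.\<close>
  define c0 :: "nat \<Rightarrow> nat \<Rightarrow> nat \<times> nat \<times> nat \<times> nat" where
    "c0 x y = (if y < s then (0, x, y, 0)
               else if x < s then (1, row x, y div h + x, \<phi> (A x) (y mod h))
               else (2, x + y, 0, 0))" for x y
  define c where "c x y = c0 (min x y) (max x y)" for x y
  have c_sp: "c x y = (0, min x y, max x y, 0)" if "x < s" "y < s" for x y
    using that by (simp add: c_def c0_def)
  have c_mix: "c x y = (1, row x, y div h + x, \<phi> (A x) (y mod h))"
    "c y x = (1, row x, y div h + x, \<phi> (A x) (y mod h))" if "x < s" "\<not> y < s" for x y
    using that by (auto simp: c_def c0_def)
  have c_ord: "c x y = (2, x + y, 0, 0)" if "\<not> x < s" "\<not> y < s" for x y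
    using that by (auto simp: c_def c0_def)
  define P :: "(nat \<times> nat \<times> nat \<times> nat) set" where
    "P = {0} \<times> {..<s} \<times> {..<s} \<times> {0} \<union> {1} \<times> {..<B} \<times> {..<n div h + s + 1} \<times> {..<2 * h}
         \<union> {2} \<times> {..<2 * n} \<times> {0} \<times> {0}"
  have proper: "c x y \<noteq> c x z" if "x < n" "y < n" "z < n" "y \<noteq> x" "z \<noteq> x" "y \<noteq> z" for x y z
  proof
    assume eq: "c x y = c x z"
    show False
    proof (cases "x < s")
      case True
      show False
      proof (cases "y < s"; cases "z < s")
        assume "y < s" "z < s"
        then show False using eq True that by (auto simp: c_sp min_def max_def split: if_splits)
      next
        assume yz: "\<not> y < s" "\<not> z < s"
        then have e: "y div h = z div h" "\<phi> (A x) (y mod h) = \<phi> (A x) (z mod h)"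
          using eq True by (auto simp: c_mix)
        have "inj_on (\<phi> (A x)) {..<h}" using \<phi>A[OF True] by (simp add: bij_betw_def)
        then have "y mod h = z mod h" using e(2) h by (auto dest: inj_onD)
        then have "y = z" using e(1) by (metis div_mult_mod_eq)
        then show False using that by simp
      qed (use eq True in \<open>auto simp: c_sp c_mix\<close>)
    next
      case False
      show False
        by (cases "y < s"; cases "z < s") (use eq False that in \<open>auto simp: c_mix c_ord\<close>)
    qed
  qed
  have sn: "s < n" using s size by simp
  have inP: "c x y \<in> P" if xy: "x < n" "y < n" "x \<noteq> y" for x y
  proof -
    have mix: "(1, row x, y div h + x, \<phi> (A x) (y mod h)) \<in> P" if "x < s" "y < n" for x y
    proof -
      have "y mod h < h" using h by simp
      then have "\<phi> (A x) (y mod h) \<in> A x" using bij_betwE[OF \<phi>A[OF that(1)]] by blast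
      then have "\<phi> (A x) (y mod h) < 2 * h" using rowA[OF that(1)] by blast
      moreover have "y div h \<le> n div h" using that by (intro div_le_mono) simp
      ultimately show ?thesis using that rowA by (auto simp: P_def)
    qed
    show ?thesis
      by (cases "x < s"; cases "y < s") (use xy mix[of x y] mix[of y x] in \<open>auto simp: c_sp c_mix c_ord P_def\<close>)
  qed
  have finP: "finite P" by (auto simp: P_def)
  have cP: "card P \<le> 2 * B * n + 2 * n + (B * 4 ^ h)\<^sup>2 + 2 * B * h * (B * 4 ^ h + 1)"
  proof -
    have "card P \<le> s * s + B * ((n div h + s + 1) * (2 * h)) + 2 * n"
      unfolding P_def by (rule order_trans[OF card_Un_le] add_mono)+ (simp_all add: card_cartesian_product)
    \<comment> \<open>The quotient \<open>n div h\<close> cancels the factor \<open>h\<close> coming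
      from the tags, so the main term is \<open>2 * n\<close> colors per row.\<close>
    also have "B * ((n div h + s + 1) * (2 * h)) = 2 * B * (n div h * h) + 2 * B * h * (s + 1)"
      by (simp add: algebra_simps)
    also have "s * s + (2 * B * (n div h * h) + 2 * B * h * (s + 1)) + 2 * n
      \<le> (B * 4 ^ h) * (B * 4 ^ h) + (2 * B * n + 2 * B * h * (B * 4 ^ h + 1)) + 2 * n"
      using s by (intro add_mono mult_mono) auto
    finally show ?thesis by (simp add: power2_eq_square)
  qed
  obtain col :: "nat set \<Rightarrow> nat" where col: "proper_edge_coloring (complete_edges {..<n}) col"
    "num_colors (complete_edges {..<n}) col \<le> card P"
    "\<And>T. T \<subseteq> complete_edges {..<n} \<Longrightarrow> card {c x y |x y. {x, y} \<in> T} \<le> num_colors T col"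
    using coloring_from_pairs[of c n P] proper finP inP by (force simp: c_def min.commute max.commute)
  \<comment> \<open>A color joining two special vertices has to tag both ends, hence the bound of
    two tags per color. \<open>Min\<close> merely selects some element.\<close>
  define tags :: "nat \<times> nat \<times> nat \<times> nat \<Rightarrow> (nat \<times> nat) set" where
    "tags = (\<lambda>(k, p, q, r). if k = 0 then {(row p, Min (A p)), (row q, Min (A q))}
                            else if k = 1 then {(p, r)} else {})"
  have tags_card: "finite (tags k)" "card (tags k) \<le> 2" for k
    by (auto simp: tags_def card_insert_if split: prod.splits)
  have A_ne: "Min (A x) \<in> A x" if "x < s" for x
    using rowA[OF that] h by (intro Min_in) (auto simp: card_eq_0_iff[symmetric] intro: finite_subset)
  have tagged: "\<exists>a\<in>A x. (row x, a) \<in> tags (c x y)" if "x < s" for x y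
  proof (cases "y < s")
    case True
    then have "(row x, Min (A x)) \<in> tags (c x y)"
      using that by (auto simp: c_sp tags_def min_def max_def)
    then show ?thesis using A_ne that by blast
  next
    case False
    have "\<phi> (A x) (y mod h) \<in> A x" using bij_betwE[OF \<phi>A[OF that]] h by simp
    then show ?thesis using False that by (auto simp: c_mix tags_def)
  qed
  have "B * (h + 1) \<le> 2 * num_colors T col" if T: "is_spanning_tree {..<n} (complete_edges {..<n}) T" for T
  proof -
    define S where "S = {c x y |x y. {x, y} \<in> T}"
    have TE: "T \<subseteq> complete_edges {..<n}" using T by (simp add: is_spanning_tree_def)
    have "S \<subseteq> P"
    proof
      fix k assume "k \<in> S"
      then obtain x y where xy: "k = c x y" "{x, y} \<in> T" by (auto simp: S_def)
      then have "{x, y} \<in> complete_edges {..<n}" using TE by blast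
      then show "k \<in> P" by (simp add: edge_in_complete_edges inP xy(1))
    qed
    then have finS: "finite S" using finP finite_subset by blast
    define U where "U i = {a \<in> {..<2 * h}. (i, a) \<in> (\<Union>k\<in>S. tags k)}" for i
    \<comment> \<open>Otherwise the complement of \<open>U i\<close> contains an
      \<open>h\<close>-set \<open>X\<close>, yet the tree has an edge at the special vertex
      \<open>(i, X)\<close>, whose tag lies in both \<open>X\<close> and \<open>U i\<close>.\<close>
    have "h + 1 \<le> card (U i)" if i: "i < B" for i
    proof (rule ccontr)
      assume "\<not> h + 1 \<le> card (U i)"
      moreover have "card ({..<2 * h} - U i) = 2 * h - card (U i)"
        by (subst card_Diff_subset) (auto simp: U_def)
      ultimately have "h \<le> card ({..<2 * h} - U i)" by simp
      then obtain X where X: "X \<subseteq> {..<2 * h} - U i" "card X = h"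
        by (meson obtain_subset_with_card_n)
      then have "(i, X) \<in> Sp" using i by (auto simp: Sp_def)
      then obtain x where x: "x < s" "lab x = (i, X)"
        using lab by (metis bij_betw_iff_bijections lessThan_iff)
      have "\<exists>y. y \<in> {..<n} \<and> y \<noteq> x" using x sn by (intro exI[of _ s]) auto
      then obtain z where z: "{x, z} \<in> T"
        using spanning_tree_incident_edge[OF T, of x] x sn by auto
      obtain a where a: "a \<in> A x" "(row x, a) \<in> tags (c x z)" using tagged x by blast
      have "c x z \<in> S" using z by (auto simp: S_def)
      then have "a \<in> U i" using a x rowA[OF x(1)] by (auto simp: U_def row_def)
      then show False using a X x by (auto simp: A_def)
    qed
    then have "B * (h + 1) \<le> (\<Sum>i<B. card (U i))"
      using sum_mono[of "{..<B}" "\<lambda>_. h + 1" "\<lambda>i. card (U i)"] by simp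
    also have "\<dots> = card (Sigma {..<B} U)" by (subst card_SigmaI) (auto simp: U_def)
    also have "\<dots> \<le> card (\<Union>k\<in>S. tags k)"
      using finS tags_card by (intro card_mono) (auto simp: U_def)
    also have "\<dots> \<le> (\<Sum>k\<in>S. card (tags k))" using finS by (rule card_UN_le)
    also have "\<dots> \<le> 2 * card S" using sum_mono[of S "\<lambda>k. card (tags k)" "\<lambda>_. 2"] tags_card by simp
    also have "\<dots> \<le> 2 * num_colors T col" using col(3)[OF TE] by (simp add: S_def)
    finally show ?thesis .
  qed
  then show ?thesis using col cP by (meson le_trans)
qed

section \<open>Colorings with an elementary abelian block structure\<close>

abbreviation bxor :: "nat \<Rightarrow> nat \<Rightarrow> nat" where "bxor \<equiv> semiring_bit_operations_class.xor"

lemma bxor_less: "a < 2 ^ j \<Longrightarrow> b < 2 ^ j \<Longrightarrow> bxor a b < 2 ^ j"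
  by (metis take_bit_nat_eq_self_iff take_bit_xor)

lemma bxor_bxor: "bxor a (bxor a b) = b"
  by (simp flip: xor.assoc)

lemma bxor_eq_0: "bxor a b = 0 \<longleftrightarrow> a = b"
  by (metis bxor_bxor bit.xor_self xor_self_eq xor.right_neutral)

text \<open>The set is the coset of \<open>a\<close> under the subgroup generated by
  \<open>D\<close>. Adjoining \<open>d\<close> adds one translate of \<open>X\<close>; this at most
  doubles the size, and the result is closed because \<open>d\<close> is its own inverse.\<close>

lemma bxor_span:
  assumes "finite D"
  shows "\<exists>X. finite X \<and> card X \<le> 2 ^ card D \<and> a \<in> X \<and> (\<forall>x\<in>X. \<forall>d\<in>D. bxor x d \<in> X)"
  using assms
proof (induction D)
  case empty
  show ?case by (intro exI[of _ "{a}"]) simp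
next
  case (insert d D)
  then obtain X where X: "finite X" "card X \<le> 2 ^ card D" "a \<in> X" "\<And>x e. x \<in> X \<Longrightarrow> e \<in> D \<Longrightarrow> bxor x e \<in> X"
    by blast
  define Y where "Y = X \<union> (\<lambda>x. bxor x d) ` X"
  have "card Y \<le> card X + card ((\<lambda>x. bxor x d) ` X)" unfolding Y_def by (rule card_Un_le)
  also have "\<dots> \<le> 2 ^ card (insert d D)"
    using X(2) card_image_le[OF X(1), of "\<lambda>x. bxor x d"] insert by simp
  finally have "card Y \<le> 2 ^ card (insert d D)" .
  moreover have "bxor y e \<in> Y" if y: "y \<in> Y" and e: "e \<in> insert d D" for y e
  proof -
    have dd: "bxor (bxor x d) d = x" for x by (simp add: xor.assoc)
    have de: "bxor (bxor x d) e = bxor (bxor x e) d" for x by (simp add: xor.assoc xor.commute xor.left_commute)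
    from y consider "y \<in> X" | x where "x \<in> X" "y = bxor x d" by (auto simp: Y_def)
    then show ?thesis using e X(4) dd de unfolding Y_def by cases (metis UnI1 UnI2 image_eqI insertE)+
  qed
  moreover have "finite Y" "a \<in> Y" using X by (auto simp: Y_def)
  ultimately show ?case by blast
qed

section \<open>Cancellation of residues\<close>

lemma mod_add_left_cancel:
  fixes k l m u :: int
  assumes "(u + k) mod m = (u + l) mod m" "0 \<le> k" "k < m" "0 \<le> l" "l < m"
  shows "k = l"
proof -
  have "m dvd (u + k) - (u + l)" using assms(1) by (simp add: mod_eq_dvd_iff)
  then have "k mod m = l mod m" by (simp add: mod_eq_dvd_iff)
  then show ?thesis using assms by simp
qed

lemma mod_diff_left_cancel:
  fixes k l m u :: int
  assumes "(u - k) mod m = (u - l) mod m" "0 \<le> k" "k < m" "0 \<le> l" "l < m"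
  shows "k = l"
proof -
  have "m dvd (u - l) - (u - k)" using assms(1) by (metis mod_eq_dvd_iff)
  then have "k mod m = l mod m" by (simp add: mod_eq_dvd_iff)
  then show ?thesis using assms by simp
qed

lemma mod_diff_right_cancel:
  fixes k l m u :: int
  assumes "(k - u) mod m = (l - u) mod m" "0 \<le> k" "k < m" "0 \<le> l" "l < m"
  shows "k = l"
  using mod_add_left_cancel[of "- u" k m l] assms by simp

text \<open>A vertex \<open>(a, b, k)\<close> lies in the block \<open>a < 2 ^ j\<close>, in its half \<open>b\<close>, at position \<open>k\<close>. The halves
  of the first \<open>r\<close> blocks have \<open>h\<close> elements, all other halves \<open>h - 1\<close>. A color \<open>(d, \<beta>, i)\<close> joins
  blocks \<open>a\<close> and \<open>bxor a d\<close> or stays inside a block.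

  Between a large and a small block a color \<open>(d, \<beta>, i)\<close> with \<open>d \<noteq> 0\<close> misses exactly the vertices
  \<open>(i, 0)\<close> and \<open>(i + 2 * d + \<beta>, 1)\<close> of the large block, and between two small blocks the colors
  \<open>(d, \<beta>, h - 1)\<close> are unused. Both gaps are filled by edges inside the blocks that join the two
  halves at the differences \<open>2 * d\<close> and \<open>2 * d + 1\<close>. The number of classes of inner edges that remain
  is then the same for all blocks.\<close>

locale xor_blocks =
  fixes j r :: nat and h :: int
  assumes r: "r < 2 ^ j" and h: "2 ^ (j + 1) < h"
begin

definition H :: "nat \<Rightarrow> int" where "H a = (if a < r then h else h - 1)"

definition verts :: "(nat \<times> bool \<times> int) set" where
  "verts = Sigma {..<2 ^ j} (\<lambda>a. UNIV \<times> {0..<H a})"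

text \<open>The inner difference class \<open>g\<close> of block \<open>a\<close> fills gaps of colors with \<open>d = g div 2\<close>.\<close>

definition consumed :: "nat \<Rightarrow> int \<Rightarrow> bool" where
  "consumed a g \<longleftrightarrow> 2 \<le> g \<and> g < 2 ^ (j + 1) \<and> r \<le> bxor a (nat (g div 2))"

definition free_idx :: "nat \<Rightarrow> (bool \<times> int) set" where
  "free_idx a = {False} \<times> {0..<H a} \<union> {True} \<times> {g \<in> {1..<H a}. \<not> consumed a g}"

definition k0 :: nat where "k0 = nat (2 * h - 1 - 2 * (2 ^ j - int r))"

section \<open>Counting inner classes and vertices\<close>

lemma H_pos: "0 < H a" "2 ^ (j + 1) \<le> H a"
proof -
  have "(0::int) < 2 ^ (j + 1)" by simp
  moreover have "h - 1 \<le> H a" by (simp add: H_def)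
  ultimately show "0 < H a" "2 ^ (j + 1) \<le> H a" using h by linarith+
qed

text \<open>Each \<open>d\<close> leading from block \<open>a\<close> to another small block
  accounts for the differences \<open>2 * d\<close> and \<open>2 * d + 1\<close>. A small block is
  not its own partner, hence the extra \<open>- 1\<close>.\<close>

lemma card_consumed:
  assumes a: "a < 2 ^ j"
  shows "card {g \<in> {1..<H a}. consumed a g} = 2 * (if a < r then 2 ^ j - r else 2 ^ j - r - 1)"
proof -
  define D where "D = (\<lambda>x. bxor a x) ` ({r..<2 ^ j} - {a})"
  have "inj_on (bxor a) ({r..<2 ^ j} - {a})" by (metis bxor_bxor inj_onI)
  then have "card D = card ({r..<2 ^ j} - {a})" unfolding D_def by (rule card_image)
  also have "\<dots> = (if a < r then 2 ^ j - r else 2 ^ j - r - 1)"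
    using a by (auto simp: card_Diff_singleton_if)
  finally have cD: "card D = (if a < r then 2 ^ j - r else 2 ^ j - r - 1)" .
  have D: "d \<in> D \<longleftrightarrow> 1 \<le> d \<and> d < 2 ^ j \<and> r \<le> bxor a d" for d
  proof
    assume "d \<in> D"
    then obtain x where "d = bxor a x" "x \<in> {r..<2 ^ j} - {a}" unfolding D_def by blast
    then have x: "d = bxor a x" "r \<le> x" "x < 2 ^ j" "x \<noteq> a" by auto
    then have "d \<noteq> 0" using bxor_eq_0 by auto
    then show "1 \<le> d \<and> d < 2 ^ j \<and> r \<le> bxor a d" using x a bxor_less by (simp add: bxor_bxor)
  next
    assume d: "1 \<le> d \<and> d < 2 ^ j \<and> r \<le> bxor a d"
    have "bxor a d \<noteq> a"
    proof
      assume "bxor a d = a"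
      then have "bxor a (bxor a d) = bxor a a" by simp
      then show False using d by (simp add: bxor_bxor)
    qed
    then have "bxor a d \<in> {r..<2 ^ j} - {a}" using d a bxor_less by simp
    then show "d \<in> D" unfolding D_def using bxor_bxor[of a d] by (metis image_eqI)
  qed
  define f :: "nat \<times> bool \<Rightarrow> int" where "f = (\<lambda>(d, \<beta>). 2 * int d + of_bool \<beta>)"
  have "{g \<in> {1..<H a}. consumed a g} = f ` (D \<times> UNIV)"
  proof (intro equalityI subsetI)
    fix g assume "g \<in> {g \<in> {1..<H a}. consumed a g}"
    then have g: "2 \<le> g" "g < 2 ^ (j + 1)" "r \<le> bxor a (nat (g div 2))" by (auto simp: consumed_def)
    have "int (nat (g div 2)) < int (2 ^ j)" using g by simp
    then have "nat (g div 2) < 2 ^ j" by (simp only: of_nat_less_iff)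
    then have "nat (g div 2) \<in> D" using g unfolding D by auto
    moreover have "g = f (nat (g div 2), odd g)" using g by (auto simp: f_def elim!: evenE oddE)
    ultimately show "g \<in> f ` (D \<times> UNIV)" by blast
  next
    fix g assume "g \<in> f ` (D \<times> UNIV)"
    then obtain d \<beta> where d: "d \<in> D" "g = 2 * int d + of_bool \<beta>" by (auto simp: f_def)
    then have d': "1 \<le> d" "d < 2 ^ j" "r \<le> bxor a d" using D by auto
    have "int d < int (2 ^ j)" using d'(2) by (simp only: of_nat_less_iff)
    moreover have "(2::int) ^ (j + 1) = 2 * int (2 ^ j)" "of_bool \<beta> \<le> (1::int)" by simp_all
    ultimately have "g < 2 ^ (j + 1)" using d(2) by linarith
    moreover have "2 \<le> g" using d d' by simp
    moreover have "g div 2 = int d" using d by (cases \<beta>) auto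
    ultimately show "g \<in> {g \<in> {1..<H a}. consumed a g}"
      using d' H_pos(2)[of a] by (simp add: consumed_def)
  qed
  moreover have "inj_on f (D \<times> UNIV)" by (auto simp: inj_on_def f_def of_bool_def split: if_splits) presburger+
  ultimately show ?thesis using cD by (simp add: card_image card_cartesian_product)
qed

text \<open>A large block has \<open>2 * h - 1\<close> inner classes and loses two for each of the
  \<open>2 ^ j - r\<close> small blocks. A small block starts with two classes fewer but has one
  partner fewer, so the counts agree.\<close>

lemma card_free_idx:
  assumes a: "a < 2 ^ j"
  shows "card (free_idx a) = k0"
proof -
  have "card {g \<in> {1..<H a}. \<not> consumed a g} = card ({1..<H a} - {g \<in> {1..<H a}. consumed a g})"
    by (rule arg_cong[where f = card]) auto
  also have "\<dots> = card {1..<H a} - card {g \<in> {1..<H a}. consumed a g}"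
    by (rule card_Diff_subset) (auto intro: finite_subset[of _ "{1..<H a}"])
  finally have "card {g \<in> {1..<H a}. \<not> consumed a g}
    = nat (H a - 1) - 2 * (if a < r then 2 ^ j - r else 2 ^ j - r - 1)"
    unfolding card_consumed[OF a] by simp
  moreover have "card (free_idx a) = card {0..<H a} + card {g \<in> {1..<H a}. \<not> consumed a g}"
    unfolding free_idx_def
    by (subst card_Un_disjoint)
      (auto simp: card_cartesian_product intro!: finite_cartesian_product intro: finite_subset[of _ "{1..<H a}"])
  ultimately have card: "card (free_idx a)
    = nat (H a) + (nat (H a - 1) - 2 * (if a < r then 2 ^ j - r else 2 ^ j - r - 1))" by simp
  define A where "A = 2 ^ j - r"
  have A: "int A = 2 ^ j - int r" "A \<ge> 1" using r by (auto simp: A_def of_nat_diff)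
  have hA: "2 * int A < h" using A h by simp
  have k0: "int k0 = 2 * h - 1 - 2 * int A" unfolding k0_def A(1)[symmetric] using hA A by simp
  have "int (card (free_idx a)) = int k0"
  proof (cases "a < r")
    case True
    then have "card (free_idx a) = nat h + (nat (h - 1) - 2 * A)" using card by (simp add: H_def A_def)
    then show ?thesis using k0 hA A by linarith
  next
    case False
    then have "card (free_idx a) = nat (h - 1) + (nat (h - 2) - 2 * (A - 1))"
      using card by (simp add: H_def A_def)
    then show ?thesis using k0 hA A by linarith
  qed
  then show ?thesis by simp
qed

lemma card_verts: "int (card verts) = 2 * (2 ^ j * (h - 1) + int r)"
proof -
  have "card verts = (\<Sum>a<2 ^ j. card ((UNIV :: bool set) \<times> {0..<H a}))"
    unfolding verts_def by (rule card_SigmaI) auto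
  then have "int (card verts) = (\<Sum>a<2 ^ j. 2 * H a)"
    using H_pos by (simp add: card_cartesian_product less_imp_le)
  also have "\<dots> = (\<Sum>a<2 ^ j. 2 * (h - 1) + 2 * of_bool (a < r))"
    by (rule sum.cong) (auto simp: H_def)
  also have "\<dots> = 2 ^ j * (2 * (h - 1)) + 2 * int (card ({..<2 ^ j} \<inter> {a. a < r}))"
    by (simp add: sum.distrib flip: sum_distrib_left)
  also have "{..<2 ^ j} \<inter> {a. a < r} = {..<r}" using r by auto
  finally show ?thesis by simp
qed

text \<open>Inside a half the sum class of \<open>2 * k\<close> is missing at position
  \<open>k\<close>, so the edge joining the two copies of \<open>k\<close> takes it. This saves the
  difference class 0 and leaves \<open>2 * H a - 1\<close> classes. Differences run from half
  \<open>False\<close> to half \<open>True\<close>, independently of the order of the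
  arguments.\<close>

definition inner_idx :: "nat \<Rightarrow> bool \<Rightarrow> int \<Rightarrow> bool \<Rightarrow> int \<Rightarrow> bool \<times> int" where
  "inner_idx a b k b' k' =
     (if b = b' \<or> k = k' then (False, (k + k') mod H a)
      else (True, ((if b then k - k' else k' - k) mod H a)))"

definition inner :: "(nat \<Rightarrow> bool \<times> int \<Rightarrow> int) \<Rightarrow> nat \<Rightarrow> bool \<Rightarrow> int \<Rightarrow> bool \<Rightarrow> int \<Rightarrow> nat \<times> bool \<times> int" where
  "inner \<psi> a b k b' k' =
     (let i = inner_idx a b k b' k' in
      if fst i \<and> consumed a (snd i)
      then (nat (snd i div 2), odd (snd i), if a < r then (if b then k' else k) else h - 1)
      else (0, False, \<psi> a i))"

text \<open>Here \<open>k\<close> belongs to the large block. As \<open>l + 1\<close> takes only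
  nonzero residues modulo \<open>h\<close>, each vertex of the large block misses one index for each
  value of the second entry. The correction in half \<open>True\<close> puts the two gaps of an
  index at the difference to be filled by an inner edge.\<close>

definition mixed :: "nat \<Rightarrow> bool \<Rightarrow> int \<Rightarrow> bool \<Rightarrow> int \<Rightarrow> nat \<times> bool \<times> int" where
  "mixed d b k b' l = (d, b \<noteq> b', (k + l + 1 - of_bool b * (2 * int d + of_bool (b \<noteq> b'))) mod h)"

fun pcol :: "(nat \<Rightarrow> bool \<times> int \<Rightarrow> int) \<Rightarrow> nat \<times> bool \<times> int \<Rightarrow> nat \<times> bool \<times> int \<Rightarrow> nat \<times> bool \<times> int" where
  "pcol \<psi> (a, b, k) (a', b', l) =
     (if a = a' then inner \<psi> a b k b' l
      else if a < r \<and> \<not> a' < r then mixed (bxor a a') b k b' l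
      else if \<not> a < r \<and> a' < r then mixed (bxor a a') b' l b k
      else (bxor a a', b \<noteq> b', (k + l) mod H a))"

declare pcol.simps [simp del]

section \<open>Symmetry and properness of the block coloring\<close>

lemma inner_idx_sym: "inner_idx a b k b' k' = inner_idx a b' k' b k"
  by (auto simp: inner_idx_def add.commute)

lemma pcol_sym: "pcol \<psi> u w = pcol \<psi> w u"
proof -
  obtain a b k a' b' l where uw: "u = (a, b, k)" "w = (a', b', l)" by (metis prod_cases3)
  have "inner \<psi> a b k b' l = inner \<psi> a b' l b k"
    using inner_idx_sym[of a b k b' l] by (auto simp: inner_def Let_def inner_idx_def)
  then show ?thesis unfolding uw
    by (auto simp: pcol.simps xor.commute add.commute H_def)
qed

text \<open>The disconnection argument rests on this: the first entry of a color is the only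
  possible nontrivial move between blocks.\<close>

lemma pcol_shift:
  "fst (pcol \<psi> (a, b, k) (a', b', l)) = bxor a a' \<or> a = a'"
  by (auto simp: pcol.simps mixed_def)

lemma inner_idx_range:
  assumes "0 \<le> k" "k < H a" "0 \<le> k'" "k' < H a"
  shows "inner_idx a b k b' k' \<in> {False} \<times> {0..<H a} \<union> {True} \<times> {1..<H a}"
proof -
  have R: "0 \<le> x mod H a" "x mod H a < H a" for x using H_pos[of a] by auto
  have "1 \<le> (x - y) mod H a" if "x \<noteq> y" "0 \<le> x" "x < H a" "0 \<le> y" "y < H a" for x y
  proof -
    have "(x - y) mod H a \<noteq> 0" using mod_diff_right_cancel[of x y "H a" y] that by auto
    then show ?thesis using R(1)[of "x - y"] by linarith
  qed
  then show ?thesis using assms R by (simp add: inner_idx_def)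
qed

text \<open>Cancellation modulo \<open>H a\<close> determines the position of the neighbor. In a sum
  class the half follows: a neighbor at position \<open>k\<close> lies in the other half, any other
  neighbor in the same half.\<close>

lemma inner_idx_inj:
  assumes "0 \<le> k" "k < H a" "0 \<le> l" "l < H a" "0 \<le> m" "m < H a"
    and "(b', l) \<noteq> (b, k)" "(c', m) \<noteq> (b, k)" and eq: "inner_idx a b k b' l = inner_idx a b k c' m"
  shows "(b', l) = (c', m)"
proof (cases "b = b' \<or> k = l")
  case True
  then have "b = c' \<or> k = m" "(k + l) mod H a = (k + m) mod H a"
    using eq by (auto simp: inner_idx_def split: if_splits)
  then show ?thesis using True mod_add_left_cancel[of k l "H a" m] assms by auto
next
  case False
  then have ne: "\<not> (b = c' \<or> k = m)" using eq by (auto simp: inner_idx_def split: if_splits)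
  have "l = m"
  proof (cases b)
    case True
    then have "(k - l) mod H a = (k - m) mod H a" using eq False ne by (simp add: inner_idx_def)
    then show ?thesis using mod_diff_left_cancel assms by blast
  next
    case False
    then have "(l - k) mod H a = (m - k) mod H a" using eq \<open>\<not> (b = b' \<or> k = l)\<close> ne by (simp add: inner_idx_def)
    then show ?thesis using mod_diff_right_cancel assms by blast
  qed
  then show ?thesis using False ne by auto
qed

text \<open>Only gap-filling inner edges could clash with an edge leaving the block. In a large
  block a clash makes \<open>m + 1\<close> divisible by \<open>h\<close> although
  \<open>0 \<le> m < h - 1\<close>; in a small block \<open>h - 1\<close> would be a residue modulo
  \<open>h - 1\<close>.\<close>

lemma inner_cross_ne:
  assumes u: "(a, b, k) \<in> verts" and p: "(a, b', l) \<in> verts" and q: "(a', c', m) \<in> verts" "a' \<noteq> a"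
  shows "inner \<psi> a b k b' l \<noteq> pcol \<psi> (a, b, k) (a', c', m)"
proof
  assume eq: "inner \<psi> a b k b' l = pcol \<psi> (a, b, k) (a', c', m)"
  define i where "i = inner_idx a b k b' l"
  define g where "g = snd i"
  define d where "d = bxor a a'"
  have ranges: "0 \<le> k" "k < H a" "0 \<le> l" "l < H a" "0 \<le> m" "m < H a'" using u p q by (auto simp: verts_def)
  have "fst (pcol \<psi> (a, b, k) (a', c', m)) = d"
    using pcol_shift[of \<psi> a b k a' c' m] q(2) unfolding d_def by blast
  moreover have "d \<noteq> 0" using q bxor_eq_0 by (auto simp: d_def)
  ultimately have "fst (inner \<psi> a b k b' l) = d" "d \<noteq> 0" using eq by auto
  then have cons: "fst i" "consumed a g" and gd: "nat (g div 2) = d"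
    unfolding inner_def Let_def i_def[symmetric] g_def[symmetric] by (auto split: if_splits)
  have "bxor a d = a'" by (simp add: d_def bxor_bxor)
  then have a': "\<not> a' < r" using cons gd by (auto simp: consumed_def)
  have inn: "inner \<psi> a b k b' l = (d, odd g, if a < r then (if b then l else k) else h - 1)"
    using cons gd by (simp add: inner_def Let_def i_def[symmetric] g_def[symmetric])
  show False
  proof (cases "a < r")
    case True
    then have Ha: "H a = h" "H a' = h - 1" using a' by (auto simp: H_def)
    have e: "odd g \<longleftrightarrow> b \<noteq> c'"
      "(if b then l else k) = (k + m + 1 - of_bool b * (2 * int d + of_bool (b \<noteq> c'))) mod h"
      using eq inn True a' q by (auto simp: pcol.simps mixed_def d_def)
    have "g \<ge> 0" using cons by (simp add: consumed_def)
    then have g: "2 * int d + of_bool (b \<noteq> c') = g"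
      using gd e(1) by (auto elim!: evenE oddE)
    have gg: "g = (if b then k - l else l - k) mod h"
      using cons(1) Ha by (auto simp: g_def i_def inner_idx_def split: if_splits)
    have "(u + (m + 1)) mod h = u mod h \<Longrightarrow> False" for u
    proof -
      assume "(u + (m + 1)) mod h = u mod h"
      then have "m + 1 = 0" using mod_add_left_cancel[of u "m + 1" h 0] ranges Ha by auto
      then show False using ranges by simp
    qed
    moreover have "(if b then l else k) mod h = (if b then l else k)" using ranges Ha by auto
    ultimately show False
    proof (cases b)
      case True
      have "l mod h = (k + m + 1 - g) mod h" using e(2) g True ranges Ha by simp
      also have "\<dots> = (k + m + 1 - (k - l)) mod h" unfolding gg using True by (simp add: mod_diff_right_eq)
      also have "\<dots> = (l + (m + 1)) mod h" by (simp add: algebra_simps)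
      finally show False using \<open>\<And>u. (u + (m + 1)) mod h = u mod h \<Longrightarrow> False\<close>[of l] by simp
    next
      case False
      have "k mod h = (k + (m + 1)) mod h" using e(2) False ranges Ha by (simp add: add.assoc)
      then show False using \<open>\<And>u. (u + (m + 1)) mod h = u mod h \<Longrightarrow> False\<close>[of k] by simp
    qed
  next
    case False
    then have "h - 1 = (k + m) mod (h - 1)" using eq inn a' q by (simp add: pcol.simps H_def)
    moreover have "h - 1 > 0" using H_pos[of a] False by (simp add: H_def)
    ultimately show False using pos_mod_bound[of "h - 1" "k + m"] by simp
  qed
qed

lemma pcol_proper:
  assumes \<psi>: "\<And>a. a < 2 ^ j \<Longrightarrow> inj_on (\<psi> a) (free_idx a)"
    and u: "u \<in> verts" and p: "p \<in> verts" "p \<noteq> u" and q: "q \<in> verts" "q \<noteq> u" "p \<noteq> q"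
  shows "pcol \<psi> u p \<noteq> pcol \<psi> u q"
proof
  assume eq: "pcol \<psi> u p = pcol \<psi> u q"
  obtain a b k where U: "u = (a, b, k)" by (metis prod_cases3)
  obtain a1 b1 k1 where P: "p = (a1, b1, k1)" by (metis prod_cases3)
  obtain a2 b2 k2 where Q: "q = (a2, b2, k2)" by (metis prod_cases3)
  have a: "a < 2 ^ j" using u U by (simp add: verts_def)
  have ranges: "0 \<le> k" "k < H a" "0 \<le> k1" "k1 < H a1" "0 \<le> k2" "k2 < H a2"
    using u p q by (auto simp: verts_def U P Q)
  consider "a1 = a" "a2 = a" | "a1 = a" "a2 \<noteq> a" | "a1 \<noteq> a" "a2 = a" | "a1 \<noteq> a" "a2 \<noteq> a" by blast
  then show False
  proof cases
    case 1
    define i1 where "i1 = inner_idx a b k b1 k1"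
    define i2 where "i2 = inner_idx a b k b2 k2"
    have kk: "k1 < H a" "k2 < H a" using ranges 1 by simp_all
    have R: "i1 \<in> {False} \<times> {0..<H a} \<union> {True} \<times> {1..<H a}"
      "i2 \<in> {False} \<times> {0..<H a} \<union> {True} \<times> {1..<H a}"
      unfolding i1_def i2_def by (rule inner_idx_range; use ranges kk in simp)+
    have e: "inner \<psi> a b k b1 k1 = inner \<psi> a b k b2 k2" using eq 1 by (simp add: U P Q pcol.simps)
    \<comment> \<open>Gap-filling colors have a nonzero first entry, unlike the colors obtained from
      \<open>\<psi>\<close>.\<close>
    have pos: "nat (g div 2) \<noteq> 0" if "consumed a g" for g using that by (auto simp: consumed_def)
    have "i1 = i2"
    proof (cases "fst i1 \<and> consumed a (snd i1)")
      case True
      then have "fst i2 \<and> consumed a (snd i2)"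
        using e pos[of "snd i1"] by (auto simp: inner_def Let_def i1_def[symmetric] i2_def[symmetric] split: if_splits)
      moreover from this have "nat (snd i1 div 2) = nat (snd i2 div 2)" "odd (snd i1) = odd (snd i2)"
        using e True by (auto simp: inner_def Let_def i1_def[symmetric] i2_def[symmetric])
      moreover from calculation have "snd i1 \<ge> 0" "snd i2 \<ge> 0" using True by (auto simp: consumed_def)
      ultimately have "snd i1 = snd i2"
        by (metis div_mult_mod_eq eq_nat_nat_iff parity_cases pos_imp_zdiv_nonneg_iff zero_less_numeral)
      then show ?thesis using True \<open>fst i2 \<and> consumed a (snd i2)\<close> by (simp add: prod_eq_iff)
    next
      case False
      then have F2: "\<not> (fst i2 \<and> consumed a (snd i2))"
        using e pos[of "snd i2"] by (auto simp: inner_def Let_def i1_def[symmetric] i2_def[symmetric] split: if_splits)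
      then have "\<psi> a i1 = \<psi> a i2"
        using e False by (auto simp: inner_def Let_def i1_def[symmetric] i2_def[symmetric])
      moreover have "i1 \<in> free_idx a" "i2 \<in> free_idx a" using R False F2 by (auto simp: free_idx_def)
      ultimately show ?thesis using \<psi>[OF a] by (meson inj_onD)
    qed
    then have "(b1, k1) = (b2, k2)"
      unfolding i1_def i2_def using ranges 1 p q by (intro inner_idx_inj[of k a k1 k2 b1 b b2]) (auto simp: U P Q)
    then show False using 1 q by (simp add: P Q)
  next
    case 2
    then show False using inner_cross_ne[of a b k b1 k1 a2 b2 k2 \<psi>] eq u p q by (simp add: U P Q pcol.simps)
  next
    case 3
    then show False using inner_cross_ne[of a b k b2 k2 a1 b1 k1 \<psi>] eq u p q by (simp add: U P Q pcol.simps)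
  next
    case 4
    \<comment> \<open>For two edges leaving the block the first entry determines the target block,
      the second the half, and the third, by cancellation, the position.\<close>
    have "bxor a a1 = bxor a a2" using eq 4 pcol_shift unfolding U P Q by metis
    then have a12: "a1 = a2" by (metis bxor_bxor)
    have Hh: "H a' = h" if "a' < r" for a' using that by (simp add: H_def)
    have Hh1: "H a' \<le> h" for a' by (simp add: H_def)
    have b12: "b1 = b2" using eq 4 a12 by (auto simp: U P Q pcol.simps mixed_def split: if_splits)
    have "k1 = k2"
    proof (cases "a < r \<longleftrightarrow> a1 < r")
      case True
      then have "(k + k1) mod H a = (k + k2) mod H a" "H a1 = H a"
        using eq 4 a12 by (auto simp: U P Q pcol.simps H_def)
      then show ?thesis using mod_add_left_cancel[of k k1 "H a" k2] ranges a12 by simp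
    next
      case False
      define s where "s = (if a < r then k + 1 - of_bool b * (2 * int (bxor a a1) + of_bool (b \<noteq> b1))
                                    else k + 1 - of_bool b1 * (2 * int (bxor a a1) + of_bool (b1 \<noteq> b)))"
      have "(s + k1) mod h = (s + k2) mod h"
        using eq 4 a12 b12 False unfolding U P Q s_def by (auto simp: pcol.simps mixed_def algebra_simps)
      then show ?thesis using mod_add_left_cancel[of s k1 h k2] ranges a12 Hh1[of a2] by simp
    qed
    then show False using a12 b12 q by (simp add: P Q)
  qed
qed

section \<open>The colors in use and their number\<close>

definition palette :: "(nat \<times> bool \<times> int) set" where
  "palette = {1..<2 ^ j} \<times> UNIV \<times> {0..<h} \<union> {0} \<times> {False} \<times> {0..<int k0}"

lemma pcol_in_palette:
  assumes \<psi>: "\<And>a. a < 2 ^ j \<Longrightarrow> \<psi> a ` free_idx a \<subseteq> {0..<int k0}"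
    and u: "u \<in> verts" and p: "p \<in> verts"
  shows "pcol \<psi> u p \<in> palette"
proof -
  obtain a b k where U: "u = (a, b, k)" by (metis prod_cases3)
  obtain a' b' l where P: "p = (a', b', l)" by (metis prod_cases3)
  have ranges: "a < 2 ^ j" "a' < 2 ^ j" "0 \<le> k" "k < H a" "0 \<le> l" "l < H a'"
    using u p by (auto simp: verts_def U P)
  have hpos: "0 < h" "H x \<le> h" "h - 1 \<le> H x" for x using H_pos(1)[of x] by (auto simp: H_def split: if_splits)
  show ?thesis
  proof (cases "a = a'")
    case True
    then have P': "p = (a, b', l)" using P by simp
    define i where "i = inner_idx a b k b' l"
    have R: "i \<in> {False} \<times> {0..<H a} \<union> {True} \<times> {1..<H a}"
      unfolding i_def by (rule inner_idx_range; use ranges True in simp)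
    show ?thesis
    proof (cases "fst i \<and> consumed a (snd i)")
      case c: True
      then have "2 \<le> snd i" "snd i < 2 ^ (j + 1)" by (auto simp: consumed_def)
      then have d: "1 \<le> snd i div 2" "snd i div 2 < int (2 ^ j)" by auto
      then have "nat (snd i div 2) \<in> {1..<2 ^ j}" by (simp add: nat_less_iff)
      moreover have "(if a < r then (if b then l else k) else h - 1) \<in> {0..<h}"
        using ranges True hpos(1) hpos(2)[of a] by auto
      ultimately show ?thesis using c by (simp add: U P' pcol.simps inner_def Let_def i_def[symmetric] palette_def)
    next
      case False
      then have "i \<in> free_idx a" using R by (auto simp: free_idx_def)
      then have "\<psi> a i \<in> {0..<int k0}" using \<psi>[OF ranges(1)] by blast
      moreover have "pcol \<psi> u p = (0, False, \<psi> a i)"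
        using False by (auto simp: U P' pcol.simps inner_def Let_def i_def[symmetric])
      ultimately show ?thesis by (simp add: palette_def)
    qed
  next
    case False
    have "bxor a a' \<noteq> 0" "bxor a a' < 2 ^ j" using False bxor_eq_0 bxor_less ranges by auto
    moreover have "0 \<le> x mod h" "x mod h < h" for x using hpos(1) by auto
    moreover have "0 \<le> x mod H a" "x mod H a < h" for x using H_pos(1)[of a] hpos(2)[of a]
      by (auto intro: less_le_trans[OF pos_mod_bound])
    ultimately show ?thesis using False by (auto simp: U P pcol.simps mixed_def palette_def)
  qed
qed

text \<open>The sum \<open>2 * h * (2 ^ j - 1) + k0\<close> is one less than the number of vertices,
  the optimum for a complete graph. Hence deleting one vertex still leaves at most as many colors as
  vertices.\<close>

lemma card_palette: "card palette + 1 = card verts"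
proof -
  have "card palette = (2 ^ j - 1) * (2 * nat h) + k0"
    unfolding palette_def by (subst card_Un_disjoint) (auto simp: card_cartesian_product)
  then have "int (card palette) = (2 ^ j - 1) * (2 * h) + int k0"
    using H_pos(1)[of 0] by (auto simp: of_nat_diff H_def split: if_splits)
  moreover have "int k0 = 2 * h - 1 - 2 * (2 ^ j - int r)"
  proof -
    have "2 * 2 ^ j < h" using h by simp
    moreover have "(0::int) < 2 ^ j" "0 \<le> int r" by simp_all
    ultimately have "0 \<le> 2 * h - 1 - 2 * (2 ^ j - int r)"
      unfolding right_diff_distrib by linarith
    then show ?thesis unfolding k0_def by simp
  qed
  ultimately have "int (card palette + 1) = int (card verts)"
    unfolding card_verts by (simp add: algebra_simps)
  then show ?thesis by linarith
qed

lemma exists_free_injections: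
  "\<exists>\<psi>. \<forall>a<2 ^ j. inj_on (\<psi> a) (free_idx a) \<and> \<psi> a ` free_idx a \<subseteq> {0..<int k0}"
proof -
  have "\<exists>f. inj_on f (free_idx a) \<and> f ` free_idx a \<subseteq> {0..<int k0}" if "a < 2 ^ j" for a
  proof -
    have "finite (free_idx a)"
      unfolding free_idx_def
      by (auto intro!: finite_cartesian_product intro: finite_subset[of _ "{1..<H a}"])
    then show ?thesis using card_le_inj[of "free_idx a" "{0..<int k0}"] card_free_idx[OF that] by auto
  qed
  then show ?thesis by metis
qed

end

text \<open>A tree with fewer than \<open>j\<close> colors stays in the blocks of one coset of a
  subgroup with fewer than \<open>2 ^ j\<close> elements, whereas every block contains one of the
  \<open>n\<close> vertices.\<close>

lemma exists_disconnecting_coloring: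
  fixes j n :: nat
  assumes n: "2 ^ (2 * j + 2) \<le> n"
  shows "\<exists>col :: nat set \<Rightarrow> nat. proper_edge_coloring (complete_edges {..<n}) col
    \<and> num_colors (complete_edges {..<n}) col \<le> n
    \<and> (\<forall>T. is_spanning_tree {..<n} (complete_edges {..<n}) T \<longrightarrow> j \<le> num_colors T col)"
proof -
  \<comment> \<open>\<open>2 * w\<close> is \<open>n\<close> or \<open>n + 1\<close>. Dividing
    \<open>w\<close> by \<open>2 ^ j\<close> gives \<open>h - 1\<close> as quotient and the number
    \<open>r\<close> of large blocks as remainder.\<close>
  define w where "w = (n + 1) div 2"
  define r where "r = w mod 2 ^ j"
  define h where "h = int (w div 2 ^ j) + 1"
  have "2 ^ (2 * j + 1) \<le> w" using n by (simp add: w_def)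
  then have "2 ^ (2 * j + 1) div 2 ^ j \<le> w div 2 ^ j" by (rule div_le_mono)
  also have "2 ^ (2 * j + 1) div 2 ^ j = (2 ^ (j + 1) :: nat)"
    by (metis add.assoc mult_2 nonzero_mult_div_cancel_left power_add power_not_zero zero_neq_numeral)
  finally have "int (2 ^ (j + 1)) \<le> int (w div 2 ^ j)" by (simp only: of_nat_le_iff)
  then have h: "2 ^ (j + 1) < h" by (simp add: h_def)
  have r: "r < 2 ^ j" by (simp add: r_def)
  interpret xor_blocks j r h by unfold_locales (use r h in auto)
  have "2 ^ j * (h - 1) + int r = int (2 ^ j * (w div 2 ^ j) + w mod 2 ^ j)"
    by (simp only: h_def r_def of_nat_add of_nat_mult of_nat_power of_nat_numeral add_diff_cancel_right')
  also have "\<dots> = int w" by (simp only: mult_div_mod_eq)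
  finally have "int (card verts) = 2 * int w" by (simp only: card_verts)
  then have cv: "card verts = 2 * w" by linarith
  have nv: "n \<le> card verts" "card verts \<le> n + 1" unfolding cv w_def by auto
  have "finite verts" by (auto simp: verts_def)
  then obtain pos where pos: "bij_betw pos {..<card verts} verts"
    using ex_bij_betw_nat_finite unfolding atLeast0LessThan by blast
  obtain \<psi> where \<psi>: "\<And>a. a < 2 ^ j \<Longrightarrow> inj_on (\<psi> a) (free_idx a)"
    "\<And>a. a < 2 ^ j \<Longrightarrow> \<psi> a ` free_idx a \<subseteq> {0..<int k0}"
    using exists_free_injections by blast
  define c where "c x y = pcol \<psi> (pos x) (pos y)" for x y
  have posV: "pos x \<in> verts" if "x < n" for x using pos that nv by (auto dest: bij_betwE)
  have pos_inj: "pos x \<noteq> pos y" if "x < n" "y < n" "x \<noteq> y" for x y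
    using pos that nv unfolding bij_betw_def inj_on_def by auto
  have "\<exists>col :: nat set \<Rightarrow> nat. proper_edge_coloring (complete_edges {..<n}) col
    \<and> num_colors (complete_edges {..<n}) col \<le> card palette
    \<and> (\<forall>T. T \<subseteq> complete_edges {..<n} \<longrightarrow> card {c x y |x y. {x, y} \<in> T} \<le> num_colors T col)"
  proof (rule coloring_from_pairs)
    show "c x y = c y x" for x y unfolding c_def by (rule pcol_sym)
    show "c x y \<noteq> c x z" if "x < n" "y < n" "z < n" "y \<noteq> x" "z \<noteq> x" "y \<noteq> z" for x y z
      unfolding c_def using that by (intro pcol_proper \<psi>(1) posV pos_inj) auto
    show "finite palette" by (auto simp: palette_def)
    show "c x y \<in> palette" if "x < n" "y < n" "x \<noteq> y" for x y
      unfolding c_def using that by (intro pcol_in_palette \<psi>(2) posV) auto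
  qed
  then obtain col :: "nat set \<Rightarrow> nat" where col: "proper_edge_coloring (complete_edges {..<n}) col"
    "num_colors (complete_edges {..<n}) col \<le> card palette"
    "\<And>T. T \<subseteq> complete_edges {..<n} \<Longrightarrow> card {c x y |x y. {x, y} \<in> T} \<le> num_colors T col"
    by blast
  have "card palette \<le> n" using card_palette nv by simp
  moreover have "j \<le> num_colors T col" if T: "is_spanning_tree {..<n} (complete_edges {..<n}) T" for T
  proof (rule ccontr)
    assume "\<not> j \<le> num_colors T col"
    have TE: "T \<subseteq> complete_edges {..<n}" and conn: "graph_connected {..<n} T"
      using T by (auto simp: is_spanning_tree_def is_tree_def)
    define S where "S = {c x y |x y. {x, y} \<in> T}"
    have "S \<subseteq> palette"
    proof
      fix k assume "k \<in> S"
      then obtain x y where xy: "k = c x y" "{x, y} \<in> T" by (auto simp: S_def)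
      then have "x < n" "y < n" using TE edge_in_complete_edges[of x y "{..<n}"] by auto
      then show "k \<in> palette" unfolding xy c_def by (intro pcol_in_palette \<psi>(2) posV)
    qed
    then have finS: "finite S" by (rule finite_subset) (auto simp: palette_def)
    have "card S < j" using col(3)[OF TE] \<open>\<not> j \<le> num_colors T col\<close> by (simp add: S_def)
    then have "card (fst ` S) < j" using card_image_le[OF finS, of fst] by simp
    obtain X where X: "finite X" "card X \<le> 2 ^ card (fst ` S)" "fst (pos 0) \<in> X"
      "\<And>x d. x \<in> X \<Longrightarrow> d \<in> fst ` S \<Longrightarrow> bxor x d \<in> X"
      using bxor_span[of "fst ` S" "fst (pos 0)"] finS by blast
    have "card X < 2 ^ j"
      using X(2) power_strict_increasing[OF \<open>card (fst ` S) < j\<close>, of "2::nat"] by linarith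
    then have "\<not> {..<2 ^ j} \<subseteq> X" using card_mono[OF X(1), of "{..<2 ^ j}"] by auto
    then obtain a where a: "a < 2 ^ j" "a \<notin> X" by auto
    \<comment> \<open>At most one vertex is deleted, so one of the two vertices at position 0 of the
      missed block survives.\<close>
    have "(a, b, 0) \<in> pos ` {..<card verts}" for b
      using a H_pos(1)[of a] bij_betw_imp_surj_on[OF pos] by (auto simp: verts_def)
    then obtain x y where xy: "x < card verts" "pos x = (a, False, 0)" "y < card verts" "pos y = (a, True, 0)"
      by (metis imageE lessThan_iff)
    then have "x \<noteq> y" by auto
    then have "x < n \<or> y < n" using xy nv by linarith
    then obtain z where z: "z < n" "fst (pos z) = a" using xy by (metis fst_conv)
    have "0 < n" using z by simp
    then have "(0, z) \<in> (adj T)\<^sup>*" using conn z by (simp add: graph_connected_adj)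
    then have "fst (pos z) \<in> X"
    proof (induction rule: rtrancl_induct)
      case base
      show ?case by (rule X(3))
    next
      case (step p q)
      obtain a1 b1 k1 where P: "pos p = (a1, b1, k1)" by (metis prod_cases3)
      obtain a2 b2 k2 where Q: "pos q = (a2, b2, k2)" by (metis prod_cases3)
      have "c p q \<in> S" using step by (auto simp: S_def adj_def)
      then have "fst (c p q) \<in> fst ` S" by (rule imageI)
      then have "bxor a1 (fst (c p q)) \<in> X" using X(4) step P by simp
      moreover have "fst (c p q) = bxor a1 a2 \<or> a1 = a2" unfolding c_def P Q by (rule pcol_shift)
      ultimately show ?case using step P Q bxor_bxor by auto
    qed
    then show False using z a by simp
  qed
  ultimately show ?thesis using col by (meson le_trans)
qed

section \<open>The two bounds\<close>

lemma ln_16_le: "ln (16::real) \<le> 4"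
proof -
  have "ln (16::real) = ln (2 ^ 4)" by simp
  also have "\<dots> = 4 * ln 2" by (subst ln_realpow) simp_all
  also have "\<dots> \<le> 4" using ln_le_minus_one[of "2::real"] by simp
  finally show ?thesis .
qed

lemma nat_floor_bounds:
  fixes x :: real
  assumes "0 \<le> x"
  shows "real (nat \<lfloor>x\<rfloor>) \<le> x" "x < real (nat \<lfloor>x\<rfloor>) + 1"
  using assms by linarith+

text \<open>The number of special vertices, at most \<open>B * 4 ^ h\<close>, enters quadratically,
  which suggests base 16: \<open>16 ^ h \<le> n / K\<close> and \<open>B \<le> K / 8\<close> bound
  its square by \<open>K * n / 64\<close>.\<close>

lemma coloring_large_ratio:
  fixes n :: nat and K :: real
  assumes K: "8 \<le> K" and nK: "16 \<le> real n / K"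
  shows "\<exists>col :: nat set \<Rightarrow> nat. proper_edge_coloring (complete_edges {..<n}) col
    \<and> real (num_colors (complete_edges {..<n}) col) \<le> K * real n
    \<and> (\<forall>T. is_spanning_tree {..<n} (complete_edges {..<n}) T \<longrightarrow>
         1 / 200 * K * ln (real n / K) \<le> real (num_colors T col))"
proof -
  define L where "L = log 16 (real n / K)"
  define B where "B = nat \<lfloor>K / 8\<rfloor>"
  define h where "h = nat \<lfloor>L\<rfloor>"
  have L: "1 \<le> L" unfolding L_def using nK by (subst le_log_iff) auto
  have h: "real h \<le> L" "L \<le> real h + 1" "1 \<le> h" using L unfolding h_def by linarith+
  have B: "real B \<le> K / 8" "K / 16 \<le> real B" "1 \<le> B"
  proof -
    have f: "real B \<le> K / 8" "K / 8 < real B + 1" 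
      unfolding B_def using nat_floor_bounds[of "K / 8"] K by auto
    then show "real B \<le> K / 8" "1 \<le> B" using K by linarith+
    then show "K / 16 \<le> real B" using f by linarith
  qed
  have "(16::real) ^ h = 16 powr real h" by (simp add: powr_realpow)
  also have "\<dots> \<le> 16 powr L" using h by simp
  also have "\<dots> = real n / K" unfolding L_def using nK by simp
  finally have pow: "16 ^ h \<le> real n / K" .
  have hn: "real h \<le> 4 ^ h" using of_nat_less_two_power[of h, where ?'a = real] power_mono[of 2 "4::real" h] by linarith
  have p4: "(4::real) ^ h \<le> 16 ^ h" by (intro power_mono) auto
  have BB: "real B * real B * 16 ^ h \<le> K * real n / 64"
  proof -
    have "real B * real B * 16 ^ h \<le> (K / 8) * (K / 8) * (real n / K)"
      using B pow K by (intro mult_mono) auto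
    then show ?thesis using K by (simp add: field_simps)
  qed
  have "real B * 4 ^ h \<le> (K / 8) * (real n / K)"
    using B pow p4 K by (intro mult_mono) auto
  then have "real B * 4 ^ h \<le> real n / 8" using K by simp
  moreover have n0: "real n > 0" using nK K by (metis divide_eq_0_iff gr0I not_numeral_le_zero of_nat_0 of_nat_0_less_iff)
  ultimately have "real (B * 4 ^ h) < real n" by simp
  then have size: "B * 4 ^ h < n" by (simp only: of_nat_less_iff)
  obtain col :: "nat set \<Rightarrow> nat" where col: "proper_edge_coloring (complete_edges {..<n}) col"
    "num_colors (complete_edges {..<n}) col \<le> 2 * B * n + 2 * n + (B * 4 ^ h)\<^sup>2 + 2 * B * h * (B * 4 ^ h + 1)"
    "\<And>T. is_spanning_tree {..<n} (complete_edges {..<n}) T \<Longrightarrow> B * (h + 1) \<le> 2 * num_colors T col"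
    using coloring_isolating_tags[OF h(3) B(3) size] by blast
  have "real (num_colors (complete_edges {..<n}) col)
    \<le> real (2 * B * n + 2 * n + (B * 4 ^ h)\<^sup>2 + 2 * B * h * (B * 4 ^ h + 1))"
    using col(2) by (simp only: of_nat_le_iff)
  also have "\<dots> = 2 * (real B * real n) + 2 * real n + real B * real B * (4 ^ h * 4 ^ h)
      + 2 * (real B * real B * (real h * 4 ^ h)) + 2 * (real B * real h)"
    by (simp add: power2_eq_square algebra_simps)
  also have "\<dots> \<le> K * real n"
  proof -
    have e: "(4::real) ^ h * 4 ^ h = 16 ^ h" by (simp flip: power_mult_distrib)
    have "real B * real B * (real h * 4 ^ h) \<le> real B * real B * (4 ^ h * 4 ^ h)"
      using hn by (intro mult_left_mono mult_right_mono) auto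
    moreover have Bn: "real B * real n \<le> K / 8 * real n" using B by (intro mult_right_mono) auto
    moreover have "real h \<le> real n"
    proof -
      have "real n / K \<le> real n / 1" using K by (intro divide_left_mono) auto
      then show ?thesis using hn p4 pow by linarith
    qed
    then have "real B * real h \<le> real B * real n" by (intro mult_left_mono) auto
    moreover have "8 * real n \<le> K * real n" using K by (intro mult_right_mono) auto
    ultimately show ?thesis using BB unfolding e by (simp add: field_simps)
  qed
  finally have few: "real (num_colors (complete_edges {..<n}) col) \<le> K * real n" .
  have "1 / 200 * K * ln (real n / K) \<le> real (num_colors T col)"
    if T: "is_spanning_tree {..<n} (complete_edges {..<n}) T" for T
  proof -
    have lnpos: "0 \<le> ln (real n / K)" using nK by simp
    \<comment> \<open>From \<open>B \<ge> K / 16\<close>, \<open>h + 1 \<ge> L\<close> and two tags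
      per color the constant is 1/128, relaxed to 1/200.\<close>
    have "ln (real n / K) = L * ln 16" by (simp add: L_def log_def)
    also have "\<dots> \<le> L * 4" using L ln_16_le by (intro mult_left_mono) auto
    finally have "K / 16 * (ln (real n / K) / 4) \<le> real B * (real h + 1)"
      using B K h lnpos by (intro mult_mono) auto
    also have "\<dots> = real (B * (h + 1))" by (simp add: algebra_simps)
    also have "\<dots> \<le> real (2 * num_colors T col)" using col(3)[OF T] by (simp only: of_nat_le_iff)
    finally have "K * ln (real n / K) / 128 \<le> real (num_colors T col)" by simp
    moreover have "0 \<le> K * ln (real n / K)" using lnpos K by simp
    ultimately show ?thesis by linarith
  qed
  then show ?thesis using col few by blast
qed

text \<open>For \<open>K \<le> 8\<close> the target is at most \<open>ln n / 25\<close>, while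
  \<open>j\<close>, about half of \<open>log 2 n\<close>, is chosen as large as
  \<open>2 ^ (2 * j + 2) \<le> n\<close> permits.\<close>

lemma coloring_small_ratio:
  fixes n :: nat and K :: real
  assumes K: "1 \<le> K" "K \<le> 8" and n: "8 \<le> ln (real n)"
  shows "\<exists>col :: nat set \<Rightarrow> nat. proper_edge_coloring (complete_edges {..<n}) col
    \<and> real (num_colors (complete_edges {..<n}) col) \<le> K * real n
    \<and> (\<forall>T. is_spanning_tree {..<n} (complete_edges {..<n}) T \<longrightarrow>
         1 / 200 * K * ln (real n / K) \<le> real (num_colors T col))"
proof -
  define j where "j = nat \<lfloor>(log 2 (real n) - 2) / 2\<rfloor>"
  have n0: "real n > 0" using n by (cases "n = 0") auto
  have "ln (2::real) \<le> 1" using ln_le_minus_one[of "2::real"] by simp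
  then have "ln (real n) * ln 2 \<le> ln (real n) * 1" using n by (intro mult_left_mono) auto
  then have log: "ln (real n) \<le> log 2 (real n)" by (simp add: log_def field_simps)
  have j: "real j \<le> (log 2 (real n) - 2) / 2" "(log 2 (real n) - 2) / 2 - 1 \<le> real j"
    using log n nat_floor_bounds[of "(log 2 (real n) - 2) / 2"] unfolding j_def by simp_all
  have "real (2 ^ (2 * j + 2)) = 2 powr real (2 * j + 2)" by (subst powr_realpow) simp_all
  also have "\<dots> \<le> 2 powr (log 2 (real n))" using j by simp
  also have "\<dots> = real n" using n0 by simp
  finally have "2 ^ (2 * j + 2) \<le> n" by (simp only: of_nat_le_iff)
  then obtain col :: "nat set \<Rightarrow> nat" where col: "proper_edge_coloring (complete_edges {..<n}) col"
    "num_colors (complete_edges {..<n}) col \<le> n"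
    "\<And>T. is_spanning_tree {..<n} (complete_edges {..<n}) T \<Longrightarrow> j \<le> num_colors T col"
    using exists_disconnecting_coloring by blast
  have "1 * real n \<le> K * real n" using K by (intro mult_right_mono) auto
  then have few: "real (num_colors (complete_edges {..<n}) col) \<le> K * real n" using col(2) by linarith
  have "K * ln (real n / K) \<le> 8 * ln (real n)"
  proof -
    have "ln (real n / K) \<le> ln (real n)" using K n0 by (simp add: ln_div)
    then have "K * ln (real n / K) \<le> K * ln (real n)" using K by (intro mult_left_mono) auto
    also have "\<dots> \<le> 8 * ln (real n)" using K n by (intro mult_right_mono) auto
    finally show ?thesis .
  qed
  then have "1 / 200 * K * ln (real n / K) \<le> real j"
    using j(2) log n by (simp add: diff_divide_distrib)
  then show ?thesis using col few by (meson le_trans of_nat_mono order_trans)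
qed

theorem theorem1p5:
  shows "(\<exists>C::real. \<forall>(n::nat) (K::real) (col :: nat set \<Rightarrow> nat).
            n \<ge> 1 \<and> K \<le> real n / 2 \<and>
            proper_edge_coloring (complete_edges {..<n}) col \<and>
            real (num_colors (complete_edges {..<n}) col) \<le> K * real n \<longrightarrow>
            (\<exists>T. is_spanning_tree {..<n} (complete_edges {..<n}) T \<and>
                 real (num_colors T col) \<le> C * K * ln (real n / K)))
       \<and> (\<exists>c::real. c > 0 \<and>
            (\<forall>\<^sub>F n::nat in sequentially. \<forall>K::real.
               1 \<le> K \<and> K \<le> real n / (ln (real n)) ^ 8 \<longrightarrow>
               (\<exists>col :: nat set \<Rightarrow> nat.
                  proper_edge_coloring (complete_edges {..<n}) col \<and>
                  real (num_colors (complete_edges {..<n}) col) \<le> K * real n \<and>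
                  (\<forall>T. is_spanning_tree {..<n} (complete_edges {..<n}) T \<longrightarrow>
                       real (num_colors T col) \<ge> c * K * ln (real n / K)))))"
    (is "(\<exists>C. ?upper C) \<and> (\<exists>c. c > 0 \<and> ?lower c)")
proof -
  have "?upper 10"
  proof (intro allI impI, elim conjE)
    fix n :: nat and K :: real and col :: "nat set \<Rightarrow> nat"
    assume "n \<ge> 1" "K \<le> real n / 2" "proper_edge_coloring (complete_edges {..<n}) col"
      "real (num_colors (complete_edges {..<n}) col) \<le> K * real n"
    then show "\<exists>T. is_spanning_tree {..<n} (complete_edges {..<n}) T \<and>
        real (num_colors T col) \<le> 10 * K * ln (real n / K)"
      using spanning_tree_few_colors[of "{..<n}" K col] by (simp add: lessThan_empty_iff)
  qed
  moreover have "?lower (1 / 200)"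
  proof (rule eventually_sequentiallyI[of "nat \<lceil>exp (8::real)\<rceil>"], intro allI impI, elim conjE)
    fix n :: nat and K :: real
    assume "nat \<lceil>exp (8::real)\<rceil> \<le> n" and K: "1 \<le> K" "K \<le> real n / (ln (real n)) ^ 8"
    then have "exp 8 \<le> real n" using real_nat_ceiling_ge[of "exp 8"] by (meson of_nat_mono order_trans)
    then have n: "8 \<le> ln (real n)" by (metis exp_gt_zero ln_exp ln_mono)
    show "\<exists>col :: nat set \<Rightarrow> nat.
            proper_edge_coloring (complete_edges {..<n}) col \<and>
            real (num_colors (complete_edges {..<n}) col) \<le> K * real n \<and>
            (\<forall>T. is_spanning_tree {..<n} (complete_edges {..<n}) T \<longrightarrow>
                 real (num_colors T col) \<ge> 1 / 200 * K * ln (real n / K))"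
    proof (cases "K \<le> 8")
      case True
      then show ?thesis using coloring_small_ratio[OF K(1) _ n] by blast
    next
      case False
      \<comment> \<open>This yields the ratio \<open>n / K \<ge> 16\<close> required by
        \<open>coloring_large_ratio\<close>.\<close>
      have "(8::real) ^ 8 \<le> ln (real n) ^ 8" using n by (intro power_mono) auto
      then have ln8: "16 \<le> ln (real n) ^ 8" by simp
      have "K * 16 \<le> K * ln (real n) ^ 8" using ln8 K by (intro mult_left_mono) auto
      also have "\<dots> \<le> real n" using K(2) ln8 by (subst (asm) pos_le_divide_eq) auto
      finally have "16 \<le> real n / K" using K by (simp add: field_simps)
      then show ?thesis using coloring_large_ratio[of K n] False by simp
    qed
  qed
  moreover have "(0::real) < 1 / 200" by simp
  ultimately show ?thesis by blast
qed

end
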